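(* Let $\eta\in\Theta$ be such that the irreducible Markov chain with transition matrix $P_\eta$ satisfies the drift condition: there exist a function $\mathcal V:\mathcal X\to[1,\infty)$, constants $b\in(0,1)$ and $d\ge 0$, and a finite set $C\subset\mathcal X$ with $$\sum_{y\in\mathcal X}P_\eta(x,y)\mathcal V(y)\le b\,\mathcal V(x)+d\,\mathbb I_C(x)\quad\text{for each }x\in\mathcal X .$$ Suppose the cost function $g:\mathcal X\to\mathbb R$ satisfies $|g(x)|<\mathcal V(x)$ for each $x\in\mathcal X$. Then for any $\theta\in\Theta$ such that $$D_{\theta,\eta}:=\|(P_\theta-P_\eta)Z_\eta\|_{\mathcal V}<1,$$ the difference of the long-run average costs of the policies $\pi_\theta$ and $\pi_\eta$ is bounded by $$\mu_\theta^Tg-\mu_\eta^Tg\;\le\;N_1(\theta,\eta)+N_2(\theta,\eta),$$ where $N_1(\theta,\eta)$ and $N_2(\theta,\eta)$ are finite and equal to $$N_1(\theta,\eta):=\mu_\eta^T\big(g-(\mu_\eta^Tg)e+P_\theta h_\eta-h_\eta\big),$$ $$N_2(\theta,\eta):=\frac{D_{\theta,\eta}^2}{1-D_{\theta,\eta}}\,\big\|g-(\mu_\eta^Tg)e\big\|_{\infty,\mathcal V}\,(\mu_\eta^T\mathcal V).$$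
   Context: Setting. Consider a Markov decision process with countable state space $\mathcal X$, finite action space $\mathcal A$, one-step cost function $g:\mathcal X\to\mathbb R$, and transition probabilities $P(y|x,a)$, such that the set $\{y\in\mathcal X: P(y|x,a)>0\}$ is finite for each $(x,a)\in\mathcal X\times\mathcal A$. Let $\Theta\subset\mathbb R^{m}$ be open (for some integer $m>0$). With every $\theta\in\Theta$ is associated a randomized stationary Markovian policy $\pi_\theta$ which in state $x$ chooses action $a$ with probability $\pi_\theta(a|x)$. The corresponding Markov chain has transition matrix $P_\theta(x,y)=\sum_{a\in\mathcal A}\pi_\theta(a|x)P(y|x,a)$. For each $\theta\in\Theta$ the chain with transition matrix $P_\theta$ is assumed irreducible and aperiodic. Notation. $\mathbb I_C$ is the indicator of $C$; $e=(1,1,\dots)^T$ is the vector of all ones. For a matrix $M$ on $\mathcal X\times\mathcal X$, $\|M\|_{\mathcal V}=\sup_{x\in\mathcal X}\frac1{\mathcal V(x)}\sum_{y\in\mathcal X}|M(x,y)|\mathcal V(y)$. For a vector $\nu$ on $\mathcal X$, $\|\nu\|_{\infty,\mathcal V}=\sup_{x\in\mathcal X}|\nu(x)|/\mathcal V(x)$. For a probability distribution $\mu$ and a function $f$ on $\mathcal X$, $\mu^Tf=\sum_{x}\mu(x)f(x)$. $\mu_\eta$ is the unique stationary distribution of $P_\eta$ (it exists by the drift condition, and $\mu_\eta^T\mathcal V<\infty$). $\Pi_\eta$ is the matrix with every row equal to $\mu_\eta$, i.e. $\Pi_\eta(x,y)=\mu_\eta(y)$. The fundamental matrix is $Z_\eta=\sum_{k=0}^\infty(P_\eta-\Pi_\eta)^k$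 (the series converges in $\mathcal V$-norm and $\|Z_\eta\|_{\mathcal V}<\infty$). $\mu_\theta$ is the unique stationary distribution of $P_\theta$ (it exists when $D_{\theta,\eta}<1$). $h_\eta$ is the fundamental solution of the Poisson equation for $P_\eta$ and $g$, i.e. the solution $h$ of $g(x)-\mu_\eta^Tg+\sum_yP_\eta(x,y)h(y)-h(x)=0$ for all $x\in\mathcal X$, with $\mu_\eta^T|h|<\infty$ and $\mu_\eta^Th=0$; equivalently $h_\eta=Z_\eta(g-(\mu_\eta^Tg)e)$. *)

theory Defs
  imports "HOL-Probability.Probability"
begin

text \<open>
  Matrices on a countable state space are functions \<open>'x \<Rightarrow> 'x \<Rightarrow> real\<close>. Quantities that may be
  infinite a priori (weighted norms) are \<open>ennreal\<close>-valued; the remaining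
  sums are real-valued \<open>infsum\<close>s, which are only meaningful for summable families.
\<close>

definition mat_one :: "'x \<Rightarrow> 'x \<Rightarrow> real" where
  "mat_one x y = (if x = y then 1 else 0)"

definition mat_mult :: "('x \<Rightarrow> 'x \<Rightarrow> real) \<Rightarrow> ('x \<Rightarrow> 'x \<Rightarrow> real) \<Rightarrow> 'x \<Rightarrow> 'x \<Rightarrow> real" where
  "mat_mult M N x y = (\<Sum>\<^sub>\<infinity>z. M x z * N z y)"

primrec mat_pow :: "('x \<Rightarrow> 'x \<Rightarrow> real) \<Rightarrow> nat \<Rightarrow> 'x \<Rightarrow> 'x \<Rightarrow> real" where
  "mat_pow M 0 = mat_one"
| "mat_pow M (Suc n) = mat_mult M (mat_pow M n)"

definition mat_vec :: "('x \<Rightarrow> 'x \<Rightarrow> real) \<Rightarrow> ('x \<Rightarrow> real) \<Rightarrow> 'x \<Rightarrow> real" where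
  "mat_vec M f x = (\<Sum>\<^sub>\<infinity>y. M x y * f y)"

definition mat_vnorm :: "('x \<Rightarrow> real) \<Rightarrow> ('x \<Rightarrow> 'x \<Rightarrow> real) \<Rightarrow> ennreal" where
  "mat_vnorm V M = (SUP x. (\<Sum>\<^sub>\<infinity>y. ennreal (\<bar>M x y\<bar> * V y)) / ennreal (V x))"

definition vec_vnorm :: "('x \<Rightarrow> real) \<Rightarrow> ('x \<Rightarrow> real) \<Rightarrow> ennreal" where
  "vec_vnorm V f = (SUP x. ennreal (\<bar>f x\<bar> / V x))"

definition mean_summable :: "'x pmf \<Rightarrow> ('x \<Rightarrow> real) \<Rightarrow> bool" where
  "mean_summable \<mu> f \<longleftrightarrow> (\<lambda>x. pmf \<mu> x * f x) summable_on UNIV"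

definition mean :: "'x pmf \<Rightarrow> ('x \<Rightarrow> real) \<Rightarrow> real" where
  "mean \<mu> f = (\<Sum>\<^sub>\<infinity>x. pmf \<mu> x * f x)"

definition policy_matrix ::
  "('x \<Rightarrow> 'a::finite \<Rightarrow> 'x pmf) \<Rightarrow> ('x \<Rightarrow> 'a pmf) \<Rightarrow> 'x \<Rightarrow> 'x \<Rightarrow> real" where
  "policy_matrix P \<sigma> x y = (\<Sum>a\<in>UNIV. pmf (\<sigma> x) a * pmf (P x a) y)"

definition irreducible_chain :: "('x \<Rightarrow> 'x \<Rightarrow> real) \<Rightarrow> bool" where
  "irreducible_chain Q \<longleftrightarrow> (\<forall>x y. \<exists>n. mat_pow Q n x y > 0)"

definition aperiodic_chain :: "('x \<Rightarrow> 'x \<Rightarrow> real) \<Rightarrow> bool" where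
  "aperiodic_chain Q \<longleftrightarrow> (\<forall>x. Gcd {n. n > 0 \<and> mat_pow Q n x x > 0} = 1)"

definition stationary_for :: "('x \<Rightarrow> 'x \<Rightarrow> real) \<Rightarrow> 'x pmf \<Rightarrow> bool" where
  "stationary_for Q \<mu> \<longleftrightarrow> (\<forall>y. (\<Sum>\<^sub>\<infinity>x. pmf \<mu> x * Q x y) = pmf \<mu> y)"

definition stationary :: "('x \<Rightarrow> 'x \<Rightarrow> real) \<Rightarrow> 'x pmf" where
  "stationary Q = (THE \<mu>. stationary_for Q \<mu>)"

definition stationary_matrix :: "('x \<Rightarrow> 'x \<Rightarrow> real) \<Rightarrow> 'x \<Rightarrow> 'x \<Rightarrow> real" where
  "stationary_matrix Q x y = pmf (stationary Q) y"

text \<open>The series of matrices is summed entrywise; a limit in the weighted norm is, in particular,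
  an entrywise limit.\<close>

definition fundamental_matrix :: "('x \<Rightarrow> 'x \<Rightarrow> real) \<Rightarrow> 'x \<Rightarrow> 'x \<Rightarrow> real" where
  "fundamental_matrix Q x y = (\<Sum>k. mat_pow (Q - stationary_matrix Q) k x y)"

definition centered :: "('x \<Rightarrow> 'x \<Rightarrow> real) \<Rightarrow> ('x \<Rightarrow> real) \<Rightarrow> 'x \<Rightarrow> real" where
  "centered Q g x = g x - mean (stationary Q) g"

definition poisson_solution :: "('x \<Rightarrow> 'x \<Rightarrow> real) \<Rightarrow> ('x \<Rightarrow> real) \<Rightarrow> ('x \<Rightarrow> real) \<Rightarrow> bool" where
  "poisson_solution Q g h \<longleftrightarrow>
     (\<forall>x. g x - mean (stationary Q) g + mat_vec Q h x - h x = 0) \<and>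
     mean_summable (stationary Q) (\<lambda>x. \<bar>h x\<bar>) \<and>
     mean (stationary Q) h = 0"

definition fundamental_solution :: "('x \<Rightarrow> 'x \<Rightarrow> real) \<Rightarrow> ('x \<Rightarrow> real) \<Rightarrow> 'x \<Rightarrow> real" where
  "fundamental_solution Q g = (THE h. poisson_solution Q g h)"

text \<open>In the following, \<open>Q'\<close> is the perturbed and \<open>Q\<close> the reference transition matrix.\<close>

definition deviation :: "('x \<Rightarrow> real) \<Rightarrow> ('x \<Rightarrow> 'x \<Rightarrow> real) \<Rightarrow> ('x \<Rightarrow> 'x \<Rightarrow> real) \<Rightarrow> ennreal" where
  "deviation V Q' Q = mat_vnorm V (mat_mult (Q' - Q) (fundamental_matrix Q))"

definition advantage ::
  "('x \<Rightarrow> 'x \<Rightarrow> real) \<Rightarrow> ('x \<Rightarrow> 'x \<Rightarrow> real) \<Rightarrow> ('x \<Rightarrow> real) \<Rightarrow> 'x \<Rightarrow> real" where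
  "advantage Q' Q g x =
     g x - mean (stationary Q) g + mat_vec Q' (fundamental_solution Q g) x
       - fundamental_solution Q g x"

definition N1 :: "('x \<Rightarrow> 'x \<Rightarrow> real) \<Rightarrow> ('x \<Rightarrow> 'x \<Rightarrow> real) \<Rightarrow> ('x \<Rightarrow> real) \<Rightarrow> real" where
  "N1 Q' Q g = mean (stationary Q) (advantage Q' Q g)"

text \<open>Subtraction on \<open>ennreal\<close> truncates, so the formula is only meaningful for
  \<open>deviation V Q' Q < 1\<close>.\<close>

definition N2 ::
  "('x \<Rightarrow> real) \<Rightarrow> ('x \<Rightarrow> 'x \<Rightarrow> real) \<Rightarrow> ('x \<Rightarrow> 'x \<Rightarrow> real) \<Rightarrow> ('x \<Rightarrow> real) \<Rightarrow> ennreal" where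
  "N2 V Q' Q g =
     (deviation V Q' Q)\<^sup>2 / (1 - deviation V Q' Q) * vec_vnorm V (centered Q g)
       * (\<Sum>\<^sub>\<infinity>x. ennreal (pmf (stationary Q) x * V x))"

end

theory Submission
  imports Defs
begin

text \<open>
  The drift condition makes sublevel sets of \<open>V\<close> small for a power of \<open>P\<^sub>\<eta>\<close>, so by the argument of
  Hairer and Mattingly that power contracts the seminorm
  \<open>sup \<bar>f x - f y\<bar> / (2 + \<beta> * V x + \<beta> * V y)\<close>; this yields \<open>\<mu>\<^sub>\<eta>\<close>, geometric convergence of
  \<open>P\<^sub>\<eta>\<^sup>n\<close> in the \<open>V\<close>-norm, and the fundamental matrix \<open>Z\<close> with \<open>Z P\<^sub>\<eta> = P\<^sub>\<eta> Z = Z - I + \<Pi>\<close>.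
  With \<open>M = (P\<^sub>\<theta> - P\<^sub>\<eta>) Z\<close>, whose norm \<open>D\<close> is less than 1, the signed measure
  \<open>\<nu> = \<mu>\<^sub>\<eta> (I + M + M\<^sup>2 + \<dots>)\<close> has mass 1 and is invariant under \<open>P\<^sub>\<theta>\<close>; by irreducibility an
  invariant signed measure has constant sign, so \<open>\<nu> = \<mu>\<^sub>\<theta>\<close>. For the centered cost \<open>f\<close> this gives
  \<open>\<mu>\<^sub>\<theta> f = \<nu> M f = \<mu>\<^sub>\<eta> M f + (\<nu> - \<mu>\<^sub>\<eta>) M f\<close>, where the first term is \<open>N\<^sub>1\<close> and the second is at most
  \<open>(D / (1 - D) * \<mu>\<^sub>\<eta> V) * (D * \<parallel>f\<parallel>)\<close>.
\<close>

text \<open>Only \<open>C\<close> is finite; sublevel sets of \<open>V\<close> may be infinite, so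
  irreducibility alone gives no uniform minorization on them. The drift towards \<open>C\<close>
  supplies it, at one late common time, which is why a power of the kernel contracts. The seminorm
  ignores constants because there is as yet no invariant measure to center with; that measure
  appears as the limit of the rows. No drift is known for \<open>P\<^sub>\<theta>\<close>, so its
  stationary distribution is reached only by perturbation. The entries of \<open>M\<close> may have
  both signs, so the series does not show its positivity, which has to come from irreducibility. Its
  invariance rests on \<open>Z (I - P\<^sub>\<eta>) = I - \<Pi>\<close> and on
  \<open>P\<^sub>\<theta> - P\<^sub>\<eta>\<close> annihilating constants. Associativity of infinite
  matrix products is not automatic: it is secured by the finite rows of the kernels, and by weighted
  bounds where \<open>Z\<close> takes part. Uniqueness of the Poisson solution is claimed among all
  \<mu>-integrable functions, beyond the reach of \<open>V\<close>-norm estimates, and needs a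
  separate argument on harmonic functions.\<close>

section \<open>Weighted summable vectors\<close>

text \<open>Bounding all finite partial sums expresses summability and a bound on the weighted l1
  norm at once, and the condition survives entrywise limits.\<close>

definition wbound :: "('x \<Rightarrow> real) \<Rightarrow> ('x \<Rightarrow> real) \<Rightarrow> real \<Rightarrow> bool" where
  "wbound V a c \<longleftrightarrow> (\<forall>F. finite F \<longrightarrow> (\<Sum>y\<in>F. \<bar>a y\<bar> * V y) \<le> c)"

lemma wboundI: "(\<And>F. finite F \<Longrightarrow> (\<Sum>y\<in>F. \<bar>a y\<bar> * V y) \<le> c) \<Longrightarrow> wbound V a c"
  by (simp add: wbound_def)

lemma wboundD: "wbound V a c \<Longrightarrow> finite F \<Longrightarrow> (\<Sum>y\<in>F. \<bar>a y\<bar> * V y) \<le> c"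
  by (simp add: wbound_def)

lemma wbound_nonneg: "wbound V a c \<Longrightarrow> 0 \<le> c"
  using wboundD[of V a c "{}"] by simp

lemma wbound_mono: "wbound V a c \<Longrightarrow> c \<le> c' \<Longrightarrow> wbound V a c'"
  unfolding wbound_def using order_trans by blast

lemma wbound_point: "wbound V a c \<Longrightarrow> \<bar>a y\<bar> * V y \<le> c"
  using wboundD[of V a c "{y}"] by simp

lemma wbound_add:
  assumes "\<And>y. 0 \<le> V y" "wbound V a c" "wbound V a' c'"
  shows "wbound V (\<lambda>y. a y + a' y) (c + c')"
proof (rule wboundI)
  fix F :: "'a set" assume F: "finite F"
  have "(\<Sum>y\<in>F. \<bar>a y + a' y\<bar> * V y) \<le> (\<Sum>y\<in>F. \<bar>a y\<bar> * V y + \<bar>a' y\<bar> * V y)"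
    by (intro sum_mono) (metis abs_triangle_ineq assms(1) distrib_right mult_right_mono)
  also have "\<dots> \<le> c + c'"
    using wboundD[OF assms(2) F] wboundD[OF assms(3) F] by (simp add: sum.distrib)
  finally show "(\<Sum>y\<in>F. \<bar>a y + a' y\<bar> * V y) \<le> c + c'" .
qed

lemma wbound_uminus: "wbound V a c \<Longrightarrow> wbound V (\<lambda>y. - a y) c"
  by (simp add: wbound_def)

lemma wbound_abs_summable:
  assumes "\<And>y. 0 \<le> V y" "wbound V a c"
  shows "(\<lambda>y. \<bar>a y\<bar> * V y) summable_on UNIV" "(\<Sum>\<^sub>\<infinity>y. \<bar>a y\<bar> * V y) \<le> c"
proof -
  show s: "(\<lambda>y. \<bar>a y\<bar> * V y) summable_on UNIV"
    by (rule nonneg_bdd_above_summable_on)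
       (use assms in \<open>auto intro!: bdd_aboveI2[where M = c] wboundD\<close>)
  show "(\<Sum>\<^sub>\<infinity>y. \<bar>a y\<bar> * V y) \<le> c"
    by (rule infsum_le_finite_sums[OF s]) (use assms in \<open>auto intro: wboundD\<close>)
qed

lemma wboundI_infsum:
  assumes "\<And>y. 0 \<le> V y" "(\<lambda>y. \<bar>a y\<bar> * V y) summable_on UNIV" "(\<Sum>\<^sub>\<infinity>y. \<bar>a y\<bar> * V y) \<le> c"
  shows "wbound V a c"
proof (rule wboundI)
  fix F :: "'a set" assume F: "finite F"
  have "(\<Sum>y\<in>F. \<bar>a y\<bar> * V y) \<le> (\<Sum>\<^sub>\<infinity>y. \<bar>a y\<bar> * V y)"
    by (rule finite_sum_le_infsum) (use assms F in auto)
  then show "(\<Sum>y\<in>F. \<bar>a y\<bar> * V y) \<le> c" using assms by linarith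
qed

text \<open>Duality between the weighted l1 norm of measures and matrix rows and the weighted sup
  norm of functions.\<close>

lemma wbound_pair:
  assumes V: "\<And>y. 0 \<le> V y" and a: "wbound V a c" and k: "0 \<le> k" and f: "\<And>y. \<bar>f y\<bar> \<le> k * V y"
  shows "(\<lambda>y. a y * f y) summable_on UNIV"
    and "(\<lambda>y. \<bar>a y * f y\<bar>) summable_on UNIV"
    and "(\<Sum>\<^sub>\<infinity>y. \<bar>a y * f y\<bar>) \<le> k * c"
    and "\<bar>\<Sum>\<^sub>\<infinity>y. a y * f y\<bar> \<le> k * c"
proof -
  have s: "(\<lambda>y. k * (\<bar>a y\<bar> * V y)) summable_on UNIV"
    using wbound_abs_summable[OF V a] by (intro summable_on_cmult_right)
  have le: "norm (a y * f y) \<le> k * (\<bar>a y\<bar> * V y)" for y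
    using mult_left_mono[OF f[of y], of "\<bar>a y\<bar>"] by (simp add: abs_mult algebra_simps)
  have n: "(\<lambda>y. norm (a y * f y)) summable_on UNIV"
    using Infinite_Sum.abs_summable_on_comparison_test'[OF s le] by simp
  then show "(\<lambda>y. a y * f y) summable_on UNIV" "(\<lambda>y. \<bar>a y * f y\<bar>) summable_on UNIV"
    by (auto intro: abs_summable_summable)
  have "(\<Sum>\<^sub>\<infinity>y. \<bar>a y * f y\<bar>) \<le> k * (\<Sum>\<^sub>\<infinity>y. \<bar>a y\<bar> * V y)"
    using infsum_mono[OF n s le] wbound_abs_summable[OF V a] by (simp add: infsum_cmult_right)
  also have "\<dots> \<le> k * c"
    using wbound_abs_summable[OF V a] k by (intro mult_left_mono)
  finally show i: "(\<Sum>\<^sub>\<infinity>y. \<bar>a y * f y\<bar>) \<le> k * c" .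
  have "\<bar>\<Sum>\<^sub>\<infinity>y. a y * f y\<bar> \<le> (\<Sum>\<^sub>\<infinity>y. \<bar>a y * f y\<bar>)"
    using norm_infsum_bound[OF n] by simp
  with i show "\<bar>\<Sum>\<^sub>\<infinity>y. a y * f y\<bar> \<le> k * c" by linarith
qed

text \<open>Fubini for iterated sums. The summability conclusions matter as much as the equation,
  since a real \<open>infsum\<close> over a family that is not summable is silently zero.\<close>

lemma infsum_swap_abs:
  fixes F :: "'x \<Rightarrow> 'y \<Rightarrow> real"
  assumes "\<And>x. F x summable_on UNIV" "(\<lambda>x. \<Sum>\<^sub>\<infinity>y. \<bar>F x y\<bar>) summable_on UNIV"
  shows "(\<Sum>\<^sub>\<infinity>x. \<Sum>\<^sub>\<infinity>y. F x y) = (\<Sum>\<^sub>\<infinity>y. \<Sum>\<^sub>\<infinity>x. F x y)"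
    and "(\<lambda>x. F x y) summable_on UNIV"
    and "(\<lambda>y. \<Sum>\<^sub>\<infinity>x. F x y) summable_on UNIV"
    and "(\<lambda>x. \<Sum>\<^sub>\<infinity>y. F x y) summable_on UNIV"
proof -
  have "(\<lambda>p. norm ((\<lambda>(x,y). F x y) p)) summable_on (UNIV \<times> UNIV)"
    unfolding Infinite_Sum.abs_summable_on_Sigma_iff
    using assms summable_on_iff_abs_summable_on_real[of "F _" UNIV] by (simp add: infsum_nonneg)
  then have s: "(\<lambda>(x,y). F x y) summable_on (UNIV \<times> UNIV)"
    by (rule abs_summable_summable)
  show "(\<Sum>\<^sub>\<infinity>x. \<Sum>\<^sub>\<infinity>y. F x y) = (\<Sum>\<^sub>\<infinity>y. \<Sum>\<^sub>\<infinity>x. F x y)"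
    by (rule infsum_swap_banach[OF s])
  have s': "(\<lambda>(y,x). F x y) summable_on (UNIV \<times> UNIV)"
    using s by (subst (asm) summable_on_swap) (simp add: case_prod_unfold)
  show "(\<lambda>x. F x y) summable_on UNIV"
    using summable_on_Sigma_banach[OF s'] summable_on_SigmaD1[OF s', of y] by simp
  show "(\<lambda>y. \<Sum>\<^sub>\<infinity>x. F x y) summable_on UNIV"
    using summable_on_Sigma_banach[OF s'] by simp
  show "(\<lambda>x. \<Sum>\<^sub>\<infinity>y. F x y) summable_on UNIV"
    using summable_on_Sigma_banach[OF s] by simp
qed

lemma infsum_finite_sum:
  fixes f :: "'i \<Rightarrow> 'x \<Rightarrow> real"
  assumes "\<And>i. i \<in> I \<Longrightarrow> f i summable_on A"
  shows "(\<lambda>x. \<Sum>i\<in>I. f i x) summable_on A" "(\<Sum>\<^sub>\<infinity>x\<in>A. \<Sum>i\<in>I. f i x) = (\<Sum>i\<in>I. infsum (f i) A)"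
proof -
  have "(\<lambda>x. \<Sum>i\<in>I. f i x) summable_on A \<and> (\<Sum>\<^sub>\<infinity>x\<in>A. \<Sum>i\<in>I. f i x) = (\<Sum>i\<in>I. infsum (f i) A)"
    using assms by (induction I rule: infinite_finite_induct) (auto simp: summable_on_add infsum_add)
  then show "(\<lambda>x. \<Sum>i\<in>I. f i x) summable_on A" "(\<Sum>\<^sub>\<infinity>x\<in>A. \<Sum>i\<in>I. f i x) = (\<Sum>i\<in>I. infsum (f i) A)"
    by auto
qed

section \<open>Matrices acting on signed measures\<close>

definition vec_mat :: "('x \<Rightarrow> real) \<Rightarrow> ('x \<Rightarrow> 'x \<Rightarrow> real) \<Rightarrow> 'x \<Rightarrow> real" where
  "vec_mat a M y = (\<Sum>\<^sub>\<infinity>x. a x * M x y)"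

text \<open>The weighted operator norm of a matrix is the same for its action on measures from the
  left and on functions from the right; the last claim is the adjoint relation between the two
  actions, again by Fubini.\<close>

lemma
  assumes V: "\<And>y. 1 \<le> V y" and a: "wbound V a c" and k: "0 \<le> k" and M: "\<And>x. wbound V (M x) (k * V x)"
  shows vec_mat_summable: "(\<lambda>x. a x * M x y) summable_on UNIV"
    and wbound_vec_mat: "wbound V (vec_mat a M) (k * c)"
    and vec_mat_pair: "0 \<le> l \<Longrightarrow> (\<And>y. \<bar>f y\<bar> \<le> l * V y) \<Longrightarrow>
      (\<Sum>\<^sub>\<infinity>y. vec_mat a M y * f y) = (\<Sum>\<^sub>\<infinity>x. a x * mat_vec M f x)"
proof -
  have V0: "0 \<le> V y" for y using V[of y] by linarith
  have Mp: "\<bar>M x y\<bar> \<le> k * V x" for x y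
    using wbound_point[OF M[of x], of y] mult_left_mono[OF V[of y], of "\<bar>M x y\<bar>"] by simp
  show s: "(\<lambda>x. a x * M x y) summable_on UNIV" for y
    by (rule wbound_pair(1)[OF V0 a k Mp])
  show "wbound V (vec_mat a M) (k * c)"
  proof (rule wboundI)
    fix F :: "'a set" assume F: "finite F"
    \<comment> \<open>As a function of \<open>x\<close>, this partial row sum is bounded by
      \<open>k * V x\<close>, so after exchanging the sums the duality bound applies to it.\<close>
    let ?B = "\<lambda>x. \<Sum>y\<in>F. \<bar>M x y\<bar> * V y"
    have sa: "(\<lambda>x. \<bar>a x * M x y\<bar>) summable_on UNIV" for y
      by (rule wbound_pair(2)[OF V0 a k Mp])
    have B: "\<bar>?B x\<bar> \<le> k * V x" for x
      using wboundD[OF M F, of x] V0 by (auto simp: abs_of_nonneg sum_nonneg)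
    have "(\<Sum>y\<in>F. \<bar>vec_mat a M y\<bar> * V y) \<le> (\<Sum>y\<in>F. \<Sum>\<^sub>\<infinity>x. \<bar>a x * M x y\<bar> * V y)"
    proof (intro sum_mono)
      fix y
      have "\<bar>vec_mat a M y\<bar> \<le> (\<Sum>\<^sub>\<infinity>x. \<bar>a x * M x y\<bar>)"
        unfolding vec_mat_def using norm_infsum_bound[of "\<lambda>x. a x * M x y" UNIV] sa by simp
      then show "\<bar>vec_mat a M y\<bar> * V y \<le> (\<Sum>\<^sub>\<infinity>x. \<bar>a x * M x y\<bar> * V y)"
        using V0 sa by (subst infsum_cmult_left) (auto intro: mult_right_mono)
    qed
    also have "\<dots> = (\<Sum>\<^sub>\<infinity>x. \<Sum>y\<in>F. \<bar>a x * M x y\<bar> * V y)"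
      by (rule infsum_finite_sum(2)[symmetric]) (use sa in \<open>auto intro: summable_on_cmult_left\<close>)
    also have "\<dots> = (\<Sum>\<^sub>\<infinity>x. \<bar>a x * ?B x\<bar>)"
      using V0 by (intro infsum_cong) (simp add: abs_mult mult.assoc sum_nonneg flip: sum_distrib_left)
    also have "\<dots> \<le> k * c" by (rule wbound_pair(3)[OF V0 a k B])
    finally show "(\<Sum>y\<in>F. \<bar>vec_mat a M y\<bar> * V y) \<le> k * c" .
  qed
  assume l: "0 \<le> l" and f: "\<And>y. \<bar>f y\<bar> \<le> l * V y"
  have r: "(\<lambda>y. M x y * f y) summable_on UNIV" "(\<lambda>y. \<bar>M x y * f y\<bar>) summable_on UNIV"
     "(\<Sum>\<^sub>\<infinity>y. \<bar>M x y * f y\<bar>) \<le> l * (k * V x)" for x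
    by (rule wbound_pair[OF V0 M l f])+
  have "(\<Sum>\<^sub>\<infinity>x. \<Sum>\<^sub>\<infinity>y. a x * (M x y * f y)) = (\<Sum>\<^sub>\<infinity>y. \<Sum>\<^sub>\<infinity>x. a x * (M x y * f y))"
  proof (rule infsum_swap_abs(1))
    show "(\<lambda>y. a x * (M x y * f y)) summable_on UNIV" for x
      by (intro summable_on_cmult_right r)
    have "(\<lambda>x. \<bar>a x * (\<Sum>\<^sub>\<infinity>y. \<bar>M x y * f y\<bar>)\<bar>) summable_on UNIV"
      by (rule wbound_pair(2)[OF V0 a, of "l * k"])
         (use r(3) l k in \<open>simp_all add: infsum_nonneg mult.assoc\<close>)
    also have "(\<lambda>x. \<bar>a x * (\<Sum>\<^sub>\<infinity>y. \<bar>M x y * f y\<bar>)\<bar>) = (\<lambda>x. \<Sum>\<^sub>\<infinity>y. \<bar>a x * (M x y * f y)\<bar>)"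
    proof
      fix x
      have "(\<Sum>\<^sub>\<infinity>y. \<bar>a x * (M x y * f y)\<bar>) = (\<Sum>\<^sub>\<infinity>y. \<bar>a x\<bar> * \<bar>M x y * f y\<bar>)"
        by (simp only: abs_mult)
      also have "\<dots> = \<bar>a x\<bar> * (\<Sum>\<^sub>\<infinity>y. \<bar>M x y * f y\<bar>)"
        by (rule infsum_cmult_right) (rule r)
      finally show "\<bar>a x * (\<Sum>\<^sub>\<infinity>y. \<bar>M x y * f y\<bar>)\<bar> = (\<Sum>\<^sub>\<infinity>y. \<bar>a x * (M x y * f y)\<bar>)"
        by (simp add: abs_mult[of "a x" "infsum _ _"] infsum_nonneg)
    qed
    finally show "(\<lambda>x. \<Sum>\<^sub>\<infinity>y. \<bar>a x * (M x y * f y)\<bar>) summable_on UNIV" .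
  qed
  moreover have "(\<Sum>\<^sub>\<infinity>y. a x * (M x y * f y)) = a x * mat_vec M f x" for x
    unfolding mat_vec_def by (rule infsum_cmult_right) (rule r)
  moreover have "(\<Sum>\<^sub>\<infinity>x. a x * (M x y * f y)) = vec_mat a M y * f y" for y
    unfolding vec_mat_def using infsum_cmult_left[of "f y" "\<lambda>x. a x * M x y" UNIV] s
    by (simp only: mult.assoc)
  ultimately show "(\<Sum>\<^sub>\<infinity>y. vec_mat a M y * f y) = (\<Sum>\<^sub>\<infinity>x. a x * mat_vec M f x)"
    by (simp only:)
qed

text \<open>The tail bound is stated for every \<open>n\<close> because it serves three ends:
  \<open>n = 0\<close> bounds the whole sum, \<open>n = 1\<close> the distance from the first term,
  and growing \<open>n\<close> gives convergence.\<close>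

lemma wbound_series:
  assumes V: "\<And>y. 1 \<le> V y" and r: "0 \<le> r" "r < 1" and a: "\<And>k. wbound V (a k) (c * r ^ k)"
  shows "summable (\<lambda>k. a k y)"
    and "wbound V (\<lambda>y. (\<Sum>k. a k y) - (\<Sum>k<n. a k y)) (c * r ^ n / (1 - r))"
proof -
  have V0: "0 \<le> V y" for y using V[of y] by linarith
  have "\<bar>a k y\<bar> \<le> c * r ^ k" for k y
    using wbound_point[OF a[of k], of y] mult_left_mono[OF V[of y], of "\<bar>a k y\<bar>"] by simp
  then have sa: "summable (\<lambda>k. \<bar>a k y\<bar>)" for y
    using r by (intro summable_comparison_test'[OF summable_mult[OF summable_geometric[of r], of c]]) auto
  show s: "summable (\<lambda>k. a k y)" for y by (rule summable_rabs_cancel[OF sa])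
  show "wbound V (\<lambda>y. (\<Sum>k. a k y) - (\<Sum>k<n. a k y)) (c * r ^ n / (1 - r))"
  proof (rule wboundI)
    fix F :: "'a set" assume F: "finite F"
    have st: "summable (\<lambda>k. \<bar>a (k+n) y\<bar>)" for y
      by (rule summable_ignore_initial_segment[OF sa])
    have "(\<Sum>y\<in>F. \<bar>(\<Sum>k. a k y) - (\<Sum>k<n. a k y)\<bar> * V y) \<le> (\<Sum>y\<in>F. (\<Sum>k. \<bar>a (k+n) y\<bar> * V y))"
    proof (intro sum_mono)
      fix y
      have "(\<Sum>k. a k y) - (\<Sum>k<n. a k y) = (\<Sum>k. a (k+n) y)"
        using suminf_minus_initial_segment[OF s] by simp
      moreover have "\<bar>\<Sum>k. a (k+n) y\<bar> \<le> (\<Sum>k. \<bar>a (k+n) y\<bar>)" by (rule summable_rabs[OF st])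
      ultimately show "\<bar>(\<Sum>k. a k y) - (\<Sum>k<n. a k y)\<bar> * V y \<le> (\<Sum>k. \<bar>a (k+n) y\<bar> * V y)"
        using V0 by (subst suminf_mult2[symmetric, OF st]) (simp add: mult_right_mono)
    qed
    also have "\<dots> = (\<Sum>k. \<Sum>y\<in>F. \<bar>a (k+n) y\<bar> * V y)"
      by (intro suminf_sum[symmetric] summable_mult2 st)
    also have "\<dots> \<le> (\<Sum>k. c * r ^ n * r ^ k)"
    proof (intro suminf_le summable_sum summable_mult2 st summable_mult summable_geometric)
      show "(\<Sum>y\<in>F. \<bar>a (k+n) y\<bar> * V y) \<le> c * r ^ n * r ^ k" for k
        using wboundD[OF a F, of "k+n"] by (simp add: power_add mult_ac)
    qed (use r in auto)
    also have "\<dots> = c * r ^ n / (1 - r)"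
      using r by (simp add: suminf_mult summable_geometric suminf_geometric)
    finally show "(\<Sum>y\<in>F. \<bar>(\<Sum>k. a k y) - (\<Sum>k<n. a k y)\<bar> * V y) \<le> c * r ^ n / (1 - r)" .
  qed
qed

section \<open>Chains with finite rows\<close>

text \<open>Finite rows turn the action on functions into a finite sum, so that linearity,
  associativity and pointwise limits hold for arbitrary functions without summability
  conditions.\<close>

definition row_finite :: "('x \<Rightarrow> 'x \<Rightarrow> real) \<Rightarrow> bool" where
  "row_finite M \<longleftrightarrow> (\<forall>x. finite {y. M x y \<noteq> 0})"

lemma mat_vec_superset:
  assumes "finite A" "\<And>y. y \<notin> A \<Longrightarrow> M x y = 0"
  shows "mat_vec M f x = (\<Sum>y\<in>A. M x y * f y)"
proof -
  have "mat_vec M f x = (\<Sum>\<^sub>\<infinity>y\<in>A. M x y * f y)"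
    unfolding mat_vec_def by (rule infsum_cong_neutral) (use assms in auto)
  then show ?thesis using assms by simp
qed

lemma mat_vec_row_finite:
  assumes "row_finite M"
  shows "mat_vec M f x = (\<Sum>y | M x y \<noteq> 0. M x y * f y)"
  by (rule mat_vec_superset) (use assms in \<open>auto simp: row_finite_def\<close>)

lemma row_finite_summable:
  assumes "row_finite M"
  shows "(\<lambda>y. M x y * f y) summable_on UNIV"
proof -
  have "(\<lambda>y. M x y * f y) summable_on {y. M x y \<noteq> 0}"
    using assms by (intro summable_on_finite) (simp add: row_finite_def)
  then show ?thesis by (rule summable_on_cong_neutral[THEN iffD1, rotated -1]) auto
qed

lemma mat_mult_eq_mat_vec: "mat_mult M N x y = mat_vec M (\<lambda>z. N z y) x"
  by (simp add: mat_mult_def mat_vec_def)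

lemma mat_vec_mat_one: "mat_vec mat_one f x = f x"
  by (subst mat_vec_superset[of "{x}"]) (auto simp: mat_one_def)

lemma mat_vec_of_mat_one:
  assumes "row_finite M" shows "mat_vec M (\<lambda>z. mat_one z y) x = M x y"
proof -
  have "mat_vec M (\<lambda>z. mat_one z y) x = (\<Sum>z\<in>{z. M x z \<noteq> 0} \<union> {y}. M x z * mat_one z y)"
    by (rule mat_vec_superset) (use assms in \<open>auto simp: row_finite_def\<close>)
  also have "\<dots> = M x y"
    using assms by (subst sum.remove[of _ y]) (auto simp: row_finite_def mat_one_def intro!: sum.neutral)
  finally show ?thesis .
qed

lemma row_finite_mat_one: "row_finite mat_one"
  by (simp add: row_finite_def mat_one_def)

lemma row_finite_mat_mult:
  assumes "row_finite M" "row_finite N"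
  shows "row_finite (mat_mult M N)"
  unfolding row_finite_def
proof
  fix x
  have "{y. mat_mult M N x y \<noteq> 0} \<subseteq> (\<Union>z\<in>{z. M x z \<noteq> 0}. {y. N z y \<noteq> 0})"
    by (force simp: mat_mult_eq_mat_vec mat_vec_row_finite[OF assms(1)] elim!: sum.not_neutral_contains_not_neutral)
  then show "finite {y. mat_mult M N x y \<noteq> 0}"
    by (rule finite_subset) (use assms in \<open>auto simp: row_finite_def\<close>)
qed

lemma row_finite_mat_pow: "row_finite M \<Longrightarrow> row_finite (mat_pow M n)"
  by (induction n) (simp_all add: row_finite_mat_one row_finite_mat_mult)

lemma row_finite_diff: "row_finite M \<Longrightarrow> row_finite N \<Longrightarrow> row_finite (M - N)"
  unfolding row_finite_def
proof
  fix x assume "\<forall>x. finite {y. M x y \<noteq> 0}" "\<forall>x. finite {y. N x y \<noteq> 0}"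
  then show "finite {y. (M - N) x y \<noteq> 0}"
    by - (rule finite_subset[of _ "{y. M x y \<noteq> 0} \<union> {y. N x y \<noteq> 0}"], auto)
qed

text \<open>Only the left factor has to have finite rows, since a finite sum over \<open>z\<close>
  commutes with the infinite sum over \<open>y\<close>. The right factor can therefore be the
  fundamental matrix.\<close>

lemma mat_vec_mult:
  assumes "row_finite M" "\<And>z. (\<lambda>y. N z y * f y) summable_on UNIV"
  shows "mat_vec (mat_mult M N) f x = mat_vec M (mat_vec N f) x"
proof -
  have "mat_vec (mat_mult M N) f x = (\<Sum>\<^sub>\<infinity>y. \<Sum>z | M x z \<noteq> 0. M x z * (N z y * f y))"
    unfolding mat_vec_def[of "mat_mult M N"] mat_mult_eq_mat_vec mat_vec_row_finite[OF assms(1)]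
    by (simp add: sum_distrib_right mult.assoc)
  also have "\<dots> = (\<Sum>z | M x z \<noteq> 0. \<Sum>\<^sub>\<infinity>y. M x z * (N z y * f y))"
    by (rule infsum_finite_sum) (intro summable_on_cmult_right assms)
  also have "\<dots> = (\<Sum>z | M x z \<noteq> 0. M x z * mat_vec N f z)"
    unfolding mat_vec_def by (intro sum.cong refl infsum_cmult_right assms)
  finally show ?thesis by (simp add: mat_vec_row_finite[OF assms(1)])
qed

lemma mat_vec_mult_row_finite:
  "row_finite M \<Longrightarrow> row_finite N \<Longrightarrow> mat_vec (mat_mult M N) f x = mat_vec M (mat_vec N f) x"
  by (intro mat_vec_mult row_finite_summable)

lemma mat_mult_assoc:
  assumes "row_finite M" "row_finite N"
  shows "mat_mult (mat_mult M N) K = mat_mult M (mat_mult N K)"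
  by (intro ext) (simp add: mat_mult_eq_mat_vec[of _ K] mat_mult_eq_mat_vec[of M "mat_mult N K"] mat_vec_mult_row_finite assms)

lemma mat_pow_add:
  assumes "row_finite M"
  shows "mat_pow M (m + n) = mat_mult (mat_pow M m) (mat_pow M n)"
proof (induction m)
  case 0
  show ?case by (intro ext) (simp add: mat_mult_eq_mat_vec mat_vec_mat_one)
next
  case (Suc m)
  then show ?case by (simp add: mat_mult_assoc assms row_finite_mat_pow)
qed

lemma mat_vec_pow_add:
  assumes "row_finite M"
  shows "mat_vec (mat_pow M (m + n)) f x = mat_vec (mat_pow M m) (mat_vec (mat_pow M n) f) x"
  by (simp add: mat_pow_add assms mat_vec_mult_row_finite row_finite_mat_pow)

lemma mat_vec_add: "row_finite M \<Longrightarrow> mat_vec M (\<lambda>y. f y + g y) x = mat_vec M f x + mat_vec M g x"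
  by (simp add: mat_vec_row_finite distrib_left sum.distrib)

lemma mat_vec_diff: "row_finite M \<Longrightarrow> mat_vec M (\<lambda>y. f y - g y) x = mat_vec M f x - mat_vec M g x"
  by (simp add: mat_vec_row_finite right_diff_distrib sum_subtractf)

lemma mat_vec_cmult: "row_finite M \<Longrightarrow> mat_vec M (\<lambda>y. c * f y) x = c * mat_vec M f x"
  by (simp add: mat_vec_row_finite sum_distrib_left mult.left_commute)

lemma mat_vec_sum: "row_finite M \<Longrightarrow> mat_vec M (\<lambda>y. \<Sum>i\<in>I. f i y) x = (\<Sum>i\<in>I. mat_vec M (f i) x)"
  by (simp add: mat_vec_row_finite sum_distrib_left) (rule sum.swap)

lemma mat_vec_diff_mat:
  assumes "row_finite M" "row_finite N"
  shows "mat_vec (M - N) f x = mat_vec M f x - mat_vec N f x"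
proof -
  have "row_finite (\<lambda>x y. - N x y)" using assms by (simp add: row_finite_def)
  from infsum_add[OF row_finite_summable[OF assms(1)] row_finite_summable[OF this], of x f x f]
  show ?thesis unfolding mat_vec_def by (simp add: left_diff_distrib infsum_uminus)
qed

lemma mat_vec_tendsto:
  "row_finite M \<Longrightarrow> (\<And>y. (\<lambda>n. f n y) \<longlonglongrightarrow> g y) \<Longrightarrow> (\<lambda>n. mat_vec M (f n) x) \<longlonglongrightarrow> mat_vec M g x"
  by (auto simp: mat_vec_row_finite intro!: tendsto_intros)

text \<open>Every value of \<open>f - W\<close> lies below every value of \<open>f + W\<close>, so
  the supremum of the former is a valid center. An oscillation bound is thus a weighted sup bound up
  to a constant.\<close>

lemma sandwich:
  fixes W f :: "'x \<Rightarrow> real"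
  assumes "\<And>u v. \<bar>f u - f v\<bar> \<le> W u + W v"
  shows "\<exists>c. \<forall>u. \<bar>f u - c\<bar> \<le> W u"
proof -
  define c where "c = (SUP u. f u - W u)"
  have le: "f u - W u \<le> f v + W v" for u v using assms[of u v] by linarith
  have "f u - W u \<le> c" for u unfolding c_def
    by (rule cSUP_upper) (use le in \<open>auto intro!: bdd_aboveI2\<close>)
  moreover have "c \<le> f v + W v" for v unfolding c_def
    by (rule cSUP_least) (use le in auto)
  ultimately have "\<bar>f u - c\<bar> \<le> W u" for u by (simp add: abs_le_iff algebra_simps)
  then show ?thesis by blast
qed

locale finite_chain =
  fixes Q :: "'x \<Rightarrow> 'x \<Rightarrow> real"
  assumes nonneg: "0 \<le> Q x y" and row_finite: "row_finite Q" and mat_vec_one: "mat_vec Q (\<lambda>_. 1) x = 1"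
begin

lemma mat_vec_const: "mat_vec Q (\<lambda>_. c) x = c"
  using mat_vec_cmult[OF row_finite, of c "\<lambda>_. 1" x] mat_vec_one by simp

lemma mat_vec_mono: "(\<And>y. f y \<le> g y) \<Longrightarrow> mat_vec Q f x \<le> mat_vec Q g x"
  by (auto simp: mat_vec_row_finite[OF row_finite] intro!: sum_mono mult_left_mono nonneg)

lemma mat_vec_abs: "\<bar>mat_vec Q f x\<bar> \<le> mat_vec Q (\<lambda>y. \<bar>f y\<bar>) x"
  unfolding mat_vec_row_finite[OF row_finite]
  by (rule order_trans[OF sum_abs]) (simp add: abs_mult nonneg)

lemma mat_vec_ge_entry:
  assumes "\<And>y. 0 \<le> f y" shows "Q x z * f z \<le> mat_vec Q f x"
proof (cases "Q x z = 0")
  case True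
  then show ?thesis using mat_vec_mono[of "\<lambda>_. 0" f x] assms by (simp add: mat_vec_const)
next
  case False
  show ?thesis unfolding mat_vec_row_finite[OF row_finite]
    by (rule member_le_sum[of z _ "\<lambda>y. Q x y * f y"]) (use row_finite False assms nonneg in \<open>auto simp: row_finite_def\<close>)
qed

lemma entry_le_one: "Q x y \<le> 1"
  using mat_vec_ge_entry[of "\<lambda>_. 1" x y] by (simp add: mat_vec_one)

lemma finite_chain_mat_pow: "finite_chain (mat_pow Q n)"
proof (induction n)
  case 0
  show ?case by unfold_locales (auto simp: mat_one_def[abs_def] row_finite_mat_one[unfolded mat_one_def[abs_def]] mat_vec_mat_one[unfolded mat_one_def[abs_def]])
next
  case (Suc n)
  then interpret n: finite_chain "mat_pow Q n" .
  show ?case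
  proof
    show "0 \<le> mat_pow Q (Suc n) x y" for x y
      using mat_vec_mono[of "\<lambda>_. 0" "\<lambda>z. mat_pow Q n z y" x] n.nonneg
      by (simp add: mat_mult_eq_mat_vec mat_vec_const)
    show "row_finite (mat_pow Q (Suc n))" by (rule row_finite_mat_pow[OF row_finite])
    show "mat_vec (mat_pow Q (Suc n)) (\<lambda>_. 1) x = 1" for x
      by (simp add: mat_vec_mult_row_finite row_finite n.row_finite n.mat_vec_const[abs_def] mat_vec_const)
  qed
qed

lemma mat_vec_pow_Suc: "mat_vec (mat_pow Q (Suc n)) f x = mat_vec Q (mat_vec (mat_pow Q n) f) x"
  by (simp add: mat_vec_mult_row_finite row_finite row_finite_mat_pow)

lemma mat_vec_pow_Suc2: "mat_vec (mat_pow Q (Suc n)) f x = mat_vec (mat_pow Q n) (mat_vec Q f) x"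
proof -
  have "mat_vec (mat_pow Q 1) f = mat_vec Q f"
    by (rule ext) (simp add: mat_vec_mult_row_finite row_finite row_finite_mat_one mat_vec_mat_one[abs_def])
  then show ?thesis using mat_vec_pow_add[OF row_finite, of n 1 f x] by simp
qed

lemma mat_pow_mult_le: "mat_pow Q m x y * mat_pow Q n y z \<le> mat_pow Q (m + n) x z"
  unfolding mat_pow_add[OF row_finite] mat_mult_eq_mat_vec
  by (intro finite_chain.mat_vec_ge_entry finite_chain_mat_pow finite_chain.nonneg[OF finite_chain_mat_pow])

text \<open>After centering, \<open>W - h\<close> and \<open>W + h\<close> are nonnegative, and the
  entry at \<open>z\<close> alone contributes at least \<delta> times their values there. Both
  averages of \<open>h\<close> are then close to the same number \<open>\<delta> * h z\<close>,
  which cancels in the difference; this common part is the gain of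
  \<open>2 * \<delta> * W z\<close>.\<close>

lemma oscillation_minorized:
  assumes osc: "\<And>u v. \<bar>f u - f v\<bar> \<le> W u + W v" and "\<delta> \<le> Q x z" "\<delta> \<le> Q y z"
  shows "\<bar>mat_vec Q f x - mat_vec Q f y\<bar> \<le> mat_vec Q W x + mat_vec Q W y - 2 * \<delta> * W z"
proof -
  obtain c where "\<forall>u. \<bar>f u - c\<bar> \<le> W u" using sandwich[of f W, OF osc] ..
  then have c: "\<bar>f u - c\<bar> \<le> W u" for u by simp
  define h where "h u = f u - c" for u
  have Qh: "mat_vec Q h x = mat_vec Q f x - c" for x
    unfolding h_def by (simp add: mat_vec_diff row_finite mat_vec_const)
  have "\<bar>mat_vec Q h x - \<delta> * h z\<bar> \<le> mat_vec Q W x - \<delta> * W z" if "\<delta> \<le> Q x z" for x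
  proof -
    have 1: "0 \<le> W u - h u" "0 \<le> W u + h u" for u using c[of u] unfolding h_def by linarith+
    have "\<delta> * (W z - h z) \<le> mat_vec Q W x - mat_vec Q h x"
      using mat_vec_ge_entry[of "\<lambda>u. W u - h u" x z, OF 1(1)] mult_right_mono[OF that 1(1)[of z]]
      by (simp add: mat_vec_diff row_finite)
    moreover have "\<delta> * (W z + h z) \<le> mat_vec Q W x + mat_vec Q h x"
      using mat_vec_ge_entry[of "\<lambda>u. W u + h u" x z, OF 1(2)] mult_right_mono[OF that 1(2)[of z]]
      by (simp add: mat_vec_add row_finite)
    ultimately show ?thesis unfolding right_diff_distrib distrib_left by linarith
  qed
  note this[OF assms(2)] this[OF assms(3)]
  then show ?thesis unfolding Qh by linarith
qed

end

section \<open>Invariant signed measures\<close>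

text \<open>Since rows are nonnegative and sum to one, the double family has absolute row sums
  \<open>\<bar>a x\<bar>\<close>, and Fubini shows that total mass is preserved.\<close>

lemma vec_mat_row_sum:
  fixes a :: "'x \<Rightarrow> real"
  assumes "finite_chain Q" and a: "a summable_on UNIV"
  shows "(\<lambda>x. a x * Q x y) summable_on UNIV" "vec_mat a Q summable_on UNIV"
    "(\<Sum>\<^sub>\<infinity>y. vec_mat a Q y) = (\<Sum>\<^sub>\<infinity>x. a x)"
proof -
  interpret finite_chain Q by fact
  have a': "(\<lambda>x. \<bar>a x\<bar>) summable_on UNIV"
    using a summable_on_iff_abs_summable_on_real[of a UNIV] by simp
  have q: "Q x summable_on UNIV" for x
    using row_finite_summable[OF row_finite, of x "\<lambda>_. 1"] by simp
  have row: "(\<Sum>\<^sub>\<infinity>y. c * Q x y) = c" for c x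
    using mat_vec_one[of x] infsum_cmult_right[of c "Q x" UNIV, OF q] by (simp add: mat_vec_def)
  have s: "(\<lambda>y. a x * Q x y) summable_on UNIV" for x
    by (rule summable_on_cmult_right[OF q])
  have "(\<lambda>x. \<Sum>\<^sub>\<infinity>y. \<bar>a x * Q x y\<bar>) = (\<lambda>x. \<bar>a x\<bar>)"
    by (simp add: abs_mult nonneg row)
  then have s': "(\<lambda>x. \<Sum>\<^sub>\<infinity>y. \<bar>a x * Q x y\<bar>) summable_on UNIV" using a' by simp
  note * = infsum_swap_abs[of "\<lambda>x y. a x * Q x y", OF s s']
  show "(\<lambda>x. a x * Q x y) summable_on UNIV" by (rule *(2))
  show "vec_mat a Q summable_on UNIV" unfolding vec_mat_def[abs_def] by (rule *(3))
  show "(\<Sum>\<^sub>\<infinity>y. vec_mat a Q y) = (\<Sum>\<^sub>\<infinity>x. a x)"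
    using *(1) unfolding vec_mat_def row by simp
qed

locale irreducible_finite_chain = finite_chain Q for Q :: "'x \<Rightarrow> 'x \<Rightarrow> real" +
  assumes irreducible: "\<exists>n. mat_pow Q n x y > 0"
begin

text \<open>Zeros spread backwards along transitions: if \<open>a z\<close> vanishes, then so does
  each nonnegative term \<open>a x * Q x z\<close> of the sum that equals it. Irreducibility
  connects every state to \<open>y\<close>.\<close>

lemma nonneg_invariant_zero:
  assumes a: "a summable_on UNIV" "\<And>x. 0 \<le> a x" "vec_mat a Q = a" "a y = 0"
  shows "a x = 0"
proof -
  have step: "a x = 0" if "a z = 0" "Q x z \<noteq> 0" for x z
  proof -
    have "vec_mat a Q z \<le> 0" using a(3) that by simp
    then have "a x * Q x z = 0" unfolding vec_mat_def
      by (rule nonneg_infsum_le_0D) (use a nonneg vec_mat_row_sum(1)[OF finite_chain_axioms a(1)] in auto)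
    then show ?thesis using that by simp
  qed
  have "a x = 0" if "mat_pow Q n x y \<noteq> 0" for n x
    using that
  proof (induction n arbitrary: x)
    case 0
    then show ?case using a(4) by (simp add: mat_one_def split: if_splits)
  next
    case (Suc n)
    then have "(\<Sum>z | Q x z \<noteq> 0. Q x z * mat_pow Q n z y) \<noteq> 0"
      by (simp add: mat_mult_eq_mat_vec mat_vec_row_finite[OF row_finite])
    then obtain z where "Q x z * mat_pow Q n z y \<noteq> 0" by (rule sum.not_neutral_contains_not_neutral)
    then show ?case using Suc.IH[of z] step[of z x] by auto
  qed
  then show ?thesis using irreducible[of x y] by (metis less_irrefl)
qed

text \<open>The triangle inequality gives that \<open>\<bar>a\<bar>\<close> is at most its image
  under \<open>Q\<close>. Both have the same total mass, so they agree, and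
  \<open>a + \<bar>a\<bar>\<close> is a nonnegative invariant vector that vanishes at
  \<open>y\<close>, hence everywhere.\<close>

lemma invariant_nonpos:
  assumes a: "a summable_on UNIV" "vec_mat a Q = a" "a y \<le> 0"
  shows "a x \<le> 0"
proof -
  have sa: "(\<lambda>x. \<bar>a x\<bar>) summable_on UNIV"
    using a summable_on_iff_abs_summable_on_real[of a UNIV] by simp
  note A = vec_mat_row_sum[OF finite_chain_axioms sa]
  let ?d = "\<lambda>y. vec_mat (\<lambda>x. \<bar>a x\<bar>) Q y - \<bar>a y\<bar>"
  have ge: "0 \<le> ?d y" for y
  proof -
    have "\<bar>vec_mat a Q y\<bar> \<le> (\<Sum>\<^sub>\<infinity>x. \<bar>a x\<bar> * Q x y)"
      unfolding vec_mat_def using norm_infsum_bound[of "\<lambda>x. a x * Q x y" UNIV] A(1)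
      by (simp add: abs_mult nonneg)
    then show ?thesis using a(2) by (simp add: vec_mat_def)
  qed
  have "(\<lambda>x. - \<bar>a x\<bar>) summable_on UNIV" by (simp add: summable_on_uminus sa)
  note d = summable_on_add[OF A(2) this] infsum_add[OF A(2) this]
  have d0: "vec_mat (\<lambda>x. \<bar>a x\<bar>) Q y = \<bar>a y\<bar>" for y
  proof -
    have "?d y = 0"
      by (rule nonneg_infsum_le_0D[of ?d UNIV])
         (use d ge A(3) in \<open>simp_all add: infsum_uminus\<close>)
    then show ?thesis by simp
  qed
  define p where "p x = a x + \<bar>a x\<bar>" for x
  have inv: "vec_mat p Q = p"
  proof
    fix y
    have "vec_mat p Q y = vec_mat a Q y + vec_mat (\<lambda>x. \<bar>a x\<bar>) Q y"
      unfolding vec_mat_def p_def distrib_right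
      by (rule infsum_add) (use A(1) vec_mat_row_sum(1)[OF finite_chain_axioms a(1)] in auto)
    then show "vec_mat p Q y = p y" using a(2) d0 by (simp add: p_def)
  qed
  have sp: "p summable_on UNIV" unfolding p_def[abs_def] by (intro summable_on_add a sa)
  have "0 \<le> p z" "p y = 0" for z using a(3) by (simp_all add: p_def)
  with sp have "p x = 0" by (rule nonneg_invariant_zero[OF _ _ inv])
  then show ?thesis by (simp add: p_def)
qed

text \<open>If one entry were positive, no entry could be negative, and a nonnegative vector with
  total zero vanishes. The same argument for \<open>- a\<close> gives the other inequality.\<close>

lemma invariant_sum_zero:
  assumes a: "a summable_on UNIV" "vec_mat a Q = a" "infsum a UNIV = 0"
  shows "a x = 0"
proof -
  have le: "a' x \<le> 0" if a': "a' summable_on UNIV" "vec_mat a' Q = a'" "infsum a' UNIV = 0" for a' x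
  proof (rule ccontr)
    assume "\<not> a' x \<le> 0"
    then have "0 \<le> a' z" for z using invariant_nonpos[OF a'(1,2), of z x] by linarith
    then have "a' x = 0" using nonneg_infsum_le_0D[of a' UNIV x] a' by simp
    then show False using \<open>\<not> a' x \<le> 0\<close> by simp
  qed
  have "(\<lambda>x. - a x) x \<le> 0"
  proof (rule le)
    show "vec_mat (\<lambda>x. - a x) Q = (\<lambda>x. - a x)"
    proof
      fix y show "vec_mat (\<lambda>x. - a x) Q y = - a y"
        using fun_cong[OF a(2), of y] by (simp add: vec_mat_def infsum_uminus)
    qed
  qed (use a in \<open>auto simp: infsum_uminus summable_on_uminus\<close>)
  with le[OF a, of x] show ?thesis by simp
qed

end

section \<open>Probability mass functions and uniqueness of the stationary distribution\<close>

lemma pmf_summable: "pmf \<mu> summable_on UNIV"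
  and infsum_pmf: "(\<Sum>\<^sub>\<infinity>x. pmf \<mu> x) = 1"
proof -
  show "pmf \<mu> summable_on UNIV"
    by (rule abs_summable_summable[OF abs_summable_equivalent[THEN iffD2, OF pmf_abs_summable]])
  show "(\<Sum>\<^sub>\<infinity>x. pmf \<mu> x) = 1"
    using infsetsum_infsum[OF pmf_abs_summable[of \<mu> UNIV]] infsetsum_pmf_eq_1[OF subset_UNIV, of \<mu>]
    by (simp only:)
qed

lemma pmf_of_infsum:
  fixes f :: "'x \<Rightarrow> real"
  assumes "f summable_on UNIV" "\<And>x. 0 \<le> f x" "infsum f UNIV = 1"
  obtains \<mu> where "pmf \<mu> = f"
proof
  have s: "Infinite_Set_Sum.abs_summable_on f UNIV"
    by (rule abs_summable_equivalent[THEN iffD1])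
       (rule summable_on_iff_abs_summable_on_real[THEN iffD1, OF assms(1)])
  have "(\<integral>\<^sup>+x. ennreal (f x) \<partial>count_space UNIV) = 1"
    using nn_integral_conv_infsetsum[OF s] assms infsetsum_infsum[OF s] by simp
  then show "pmf (embed_pmf f) = f"
    using assms by (intro ext pmf_embed_pmf) auto
qed

lemma stationary_for_iff_vec_mat: "stationary_for Q \<mu> \<longleftrightarrow> vec_mat (pmf \<mu>) Q = pmf \<mu>"
  by (simp add: stationary_for_def vec_mat_def fun_eq_iff)

lemma (in irreducible_finite_chain) stationary_for_unique:
  assumes "stationary_for Q \<mu>" "stationary_for Q \<nu>"
  shows "\<mu> = \<nu>"
proof (rule pmf_eqI)
  fix x
  let ?a = "\<lambda>x. pmf \<mu> x + - pmf \<nu> x"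
  have s: "(\<lambda>x. - pmf \<nu> x) summable_on UNIV" by (simp add: summable_on_uminus pmf_summable)
  have "?a x = 0"
  proof (rule invariant_sum_zero)
    show "?a summable_on UNIV" by (intro summable_on_add pmf_summable s)
    show "infsum ?a UNIV = 0"
      using infsum_add[OF pmf_summable s, of \<mu>] by (simp add: infsum_pmf infsum_uminus)
    show "vec_mat ?a Q = ?a"
    proof
      fix y
      have "(\<lambda>x. - pmf \<nu> x * Q x y) summable_on UNIV" "(\<lambda>x. pmf \<mu> x * Q x y) summable_on UNIV"
        by (rule vec_mat_row_sum(1)[OF finite_chain_axioms] s pmf_summable)+
      then have "vec_mat ?a Q y = vec_mat (pmf \<mu>) Q y - vec_mat (pmf \<nu>) Q y"
        unfolding vec_mat_def distrib_right by (subst infsum_add) (auto simp: infsum_uminus)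
      then show "vec_mat ?a Q y = ?a y" using assms by (simp add: stationary_for_iff_vec_mat)
    qed
  qed
  then show "pmf \<mu> x = pmf \<nu> x" by simp
qed

section \<open>Numerical semigroups and aperiodicity\<close>

lemma gcd_one_semigroup_cofinite:
  fixes S :: "nat set"
  assumes add: "\<And>m n. m \<in> S \<Longrightarrow> n \<in> S \<Longrightarrow> m + n \<in> S" and zero: "0 \<in> S" and "Gcd S = 1"
  shows "\<exists>N. \<forall>n\<ge>N. n \<in> S"
proof -
  have mult: "k * n \<in> S" if "n \<in> S" for k n
    using that by (induction k) (auto intro: add zero)
  \<comment> \<open>Positive differences of elements of \<open>S\<close>. The least one turns out to
    divide all of \<open>S\<close>, so it equals 1, and two consecutive numbers \<open>t\<close> and
    \<open>t + 1\<close> lie in \<open>S\<close>.\<close>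
  define D where "D = {d. 0 < d \<and> (\<exists>t. t \<in> S \<and> t + d \<in> S)}"
  have "\<exists>n\<in>S. n > 0"
  proof (rule ccontr)
    assume "\<not> ?thesis"
    then have "S = {0}" using zero by auto
    then show False using \<open>Gcd S = 1\<close> by simp
  qed
  then obtain n where "n \<in> S" "n > 0" by blast
  then have "n \<in> D" using zero by (auto simp: D_def)
  define d where "d = (LEAST d. d \<in> D)"
  have d: "d \<in> D" unfolding d_def using \<open>n \<in> D\<close> by (rule LeastI)
  then obtain t where t: "t \<in> S" "t + d \<in> S" "0 < d" by (auto simp: D_def)
  have "d dvd u" if u: "u \<in> S" for u
  proof (rule ccontr)
    assume nd: "\<not> d dvd u"
    define q where "q = u div d"
    have u_eq: "u = q * d + u mod d" by (simp add: q_def)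
    \<comment> \<open>These two elements differ by exactly the remainder of \<open>u\<close>, which
      would be a positive difference smaller than \<open>d\<close>.\<close>
    have "q * (t + d) \<in> S" "u + q * t \<in> S" using mult add t u by auto
    moreover have "u + q * t = q * (t + d) + u mod d" using u_eq unfolding distrib_left by linarith
    moreover have "0 < u mod d" using nd by (simp add: dvd_eq_mod_eq_0)
    ultimately have "u mod d \<in> D" unfolding D_def by (metis (mono_tags, lifting) mem_Collect_eq)
    then have "d \<le> u mod d" unfolding d_def by (rule Least_le)
    then show False using \<open>0 < d\<close> by (meson mod_less_divisor not_less)
  qed
  then have "d dvd Gcd S" by (rule Gcd_greatest)
  then have "d = 1" using \<open>Gcd S = 1\<close> by simp
  have "n \<in> S" if n: "n \<ge> t * t" for n
  proof (cases "t = 0")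
    case True
    then show ?thesis using mult[OF t(2), of n] \<open>d = 1\<close> by simp
  next
    case False
    \<comment> \<open>Writing \<open>n = q * t + r\<close> with \<open>r < t \<le> q\<close>, the
      number \<open>n\<close> is \<open>q - r\<close> copies of \<open>t\<close> plus
      \<open>r\<close> copies of \<open>t + 1\<close>; the threshold \<open>t * t\<close> is what
      makes \<open>t \<le> q\<close>.\<close>
    let ?q = "n div t" and ?r = "n mod t"
    have "?r < t" using False by simp
    moreover have "t \<le> ?q" using n False by (simp add: less_eq_div_iff_mult_less_eq)
    ultimately have "?r \<le> ?q" by simp
    have "(?q - ?r) * t + ?r * (t + d) \<in> S" using mult add t by auto
    also have "(?q - ?r) * t + ?r * (t + d) = (?q - ?r + ?r) * t + ?r"
      unfolding \<open>d = 1\<close> by (simp only: distrib_left distrib_right mult_1_right add.assoc)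
    also have "\<dots> = n" using \<open>?r \<le> ?q\<close> by simp
    finally show ?thesis .
  qed
  then show ?thesis by blast
qed

lemma (in irreducible_finite_chain) eventually_positive:
  assumes "aperiodic_chain Q"
  shows "\<exists>N. \<forall>n\<ge>N. mat_pow Q n x y > 0"
proof -
  have mult: "mat_pow Q (m + n) x z > 0" if "mat_pow Q m x y > 0" "mat_pow Q n y z > 0" for m n x y z
    using mat_pow_mult_le[of m x y n z] mult_pos_pos[OF that] by linarith
  \<comment> \<open>The return times form a semigroup. Time 0 belongs to it and leaves the gcd
    unchanged, although the definition of aperiodicity omits it. One path from \<open>x\<close> to
    \<open>y\<close> is appended afterwards.\<close>
  let ?S = "{n. mat_pow Q n x x > 0}"
  have "Gcd ?S = Gcd {n. n > 0 \<and> mat_pow Q n x x > 0}"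
  proof -
    have "?S = insert 0 {n. n > 0 \<and> mat_pow Q n x x > 0}" by (auto simp: mat_one_def)
    then show ?thesis by simp
  qed
  then have "Gcd ?S = 1" using assms by (simp add: aperiodic_chain_def)
  then obtain N where N: "\<forall>n\<ge>N. n \<in> ?S"
    using gcd_one_semigroup_cofinite[of ?S] mult by (auto simp: mat_one_def)
  obtain m where m: "mat_pow Q m x y > 0" using irreducible by blast
  have "mat_pow Q n x y > 0" if "n \<ge> N + m" for n
    using mult[of "n - m" x x m y] N m that by force
  then show ?thesis by blast
qed

section \<open>Geometric ergodicity\<close>

lemma convergent_geometric:
  fixes a :: "nat \<Rightarrow> real"
  assumes r: "0 < r" "r < 1" and a: "\<And>n k. \<bar>a (n + k) - a n\<bar> \<le> C * r ^ n"
  shows "convergent a"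
proof (rule Cauchy_convergent, unfold Cauchy_altdef, intro allI impI)
  fix e :: real assume e: "0 < e"
  have C: "0 \<le> C" using a[of 0 0] by simp
  obtain M where M: "r ^ M < e / (C + 1)"
    using real_arch_pow_inv[of "e / (C + 1)" r] e C r by auto
  have "dist (a m) (a n) < e" if "M \<le> m" "m < n" for m n
  proof -
    have "dist (a m) (a n) \<le> C * r ^ m" using a[of m "n - m"] that by (simp add: dist_real_def abs_minus_commute)
    also have "\<dots> \<le> (C + 1) * r ^ M" using C r that by (intro mult_mono power_decreasing) auto
    also have "\<dots> < e" using M C by (simp add: field_simps)
    finally show ?thesis .
  qed
  then show "\<exists>M. \<forall>m\<ge>M. \<forall>n>m. dist (a m) (a n) < e" by blast
qed

lemma geometric_null:
  fixes a :: "nat \<Rightarrow> real"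
  assumes "0 < r" "r < 1" "\<And>n. \<bar>a n\<bar> \<le> C * r ^ n * D"
  shows "a \<longlonglongrightarrow> 0"
proof (rule Lim_null_comparison)
  show "\<forall>\<^sub>F n in sequentially. norm (a n) \<le> C * r ^ n * D" using assms by simp
  show "(\<lambda>n. C * r ^ n * D) \<longlonglongrightarrow> 0"
    using LIMSEQ_power_zero[of r] assms by (auto intro!: tendsto_mult_left_zero tendsto_mult_right_zero)
qed

text \<open>Here \<open>p\<close> is any vector, because the lemma is already needed to show that
  the limit of the rows has mass one and is invariant.\<close>

lemma (in finite_chain) mat_vec_pow_tendsto:
  assumes V: "\<And>y. 0 \<le> V y" and r: "0 < r" "r < 1"
    and w: "\<And>n x. wbound V (\<lambda>y. mat_pow Q n x y - p y) (c * r ^ n * V x)"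
    and k: "0 \<le> k" and f: "\<And>u. \<bar>f u\<bar> \<le> k * V u"
  shows "(\<lambda>y. p y * f y) summable_on UNIV"
    and "(\<lambda>n. mat_vec (mat_pow Q n) f x) \<longlonglongrightarrow> (\<Sum>\<^sub>\<infinity>y. p y * f y)"
proof -
  have s: "(\<lambda>y. (mat_pow Q n x y - p y) * f y) summable_on UNIV"
    and le: "\<bar>\<Sum>\<^sub>\<infinity>y. (mat_pow Q n x y - p y) * f y\<bar> \<le> k * (c * r ^ n * V x)" for n
    by (rule wbound_pair(1,4)[OF V w k f])+
  have s': "(\<lambda>y. mat_pow Q n x y * f y) summable_on UNIV" for n
    by (rule row_finite_summable[OF row_finite_mat_pow[OF row_finite]])
  have "(\<lambda>y. - ((mat_pow Q 0 x y - p y) * f y)) summable_on UNIV" using s by (simp only: summable_on_uminus)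
  from summable_on_add[OF s' this, of 0] show ps: "(\<lambda>y. p y * f y) summable_on UNIV"
    by (simp add: algebra_simps)
  have "(\<Sum>\<^sub>\<infinity>y. (mat_pow Q n x y - p y) * f y) = mat_vec (mat_pow Q n) f x - (\<Sum>\<^sub>\<infinity>y. p y * f y)" for n
  proof -
    have "(\<lambda>y. (mat_pow Q n x y - p y) * f y + p y * f y) = (\<lambda>y. mat_pow Q n x y * f y)"
      by (simp add: algebra_simps)
    then show ?thesis using infsum_add[OF s[of n] ps] by (simp add: mat_vec_def)
  qed
  with le have "\<bar>mat_vec (mat_pow Q n) f x - (\<Sum>\<^sub>\<infinity>y. p y * f y)\<bar> \<le> (k * c) * r ^ n * V x" for n
    by (simp add: mult_ac)
  with r have "(\<lambda>n. mat_vec (mat_pow Q n) f x - (\<Sum>\<^sub>\<infinity>y. p y * f y)) \<longlonglongrightarrow> 0"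
    by (rule geometric_null)
  then show "(\<lambda>n. mat_vec (mat_pow Q n) f x) \<longlonglongrightarrow> (\<Sum>\<^sub>\<infinity>y. p y * f y)"
    by (simp add: LIM_zero_iff)
qed

locale drift_chain = irreducible_finite_chain Q for Q :: "'x \<Rightarrow> 'x \<Rightarrow> real" +
  fixes V :: "'x \<Rightarrow> real" and b d :: real and C :: "'x set"
  assumes aperiodic: "aperiodic_chain Q" and V_ge_1: "1 \<le> V x"
    and b: "0 < b" "b < 1" and d: "0 \<le> d" and C: "finite C"
    and drift: "mat_vec Q V x \<le> b * V x + d * indicator C x"
begin

text \<open>The fixed point of the map sending t to \<open>b * t + d\<close>: the level below which
  iterating the drift inequality settles.\<close>

definition K :: real where "K = d / (1 - b)"

lemma K: "0 \<le> K" "K * (1 - b) = d"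
  using b d by (auto simp: K_def)

lemma V_nonneg: "0 \<le> V x"
  using V_ge_1[of x] by linarith

text \<open>The term \<open>K * (1 - b ^ n)\<close> is the geometric sum of the contributions of
  \<open>d\<close>; keeping it exact is what lets the induction close.\<close>

lemma drift_pow_strong: "mat_vec (mat_pow Q n) V x \<le> b ^ n * V x + K * (1 - b ^ n)"
proof (induction n arbitrary: x)
  case 0
  show ?case by (simp add: mat_vec_mat_one)
next
  case (Suc n)
  have "mat_vec (mat_pow Q (Suc n)) V x \<le> mat_vec Q (\<lambda>x. b ^ n * V x + K * (1 - b ^ n)) x"
    unfolding mat_vec_pow_Suc by (rule mat_vec_mono) (rule Suc)
  also have "\<dots> = b ^ n * mat_vec Q V x + K * (1 - b ^ n)"
    by (simp add: mat_vec_add mat_vec_cmult row_finite mat_vec_const)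
  also have "\<dots> \<le> b ^ n * (b * V x + d) + K * (1 - b ^ n)"
  proof -
    have "d * indicator C x \<le> d" using d by (simp add: indicator_def)
    then show ?thesis using drift[of x] b by simp
  qed
  also have "\<dots> = b ^ Suc n * V x + K * (1 - b ^ Suc n)"
    using arg_cong[OF K(2), of "\<lambda>t. b ^ n * t"] by (simp add: algebra_simps)
  finally show ?case .
qed

lemma drift_pow: "mat_vec (mat_pow Q n) V x \<le> b ^ n * V x + K"
proof -
  have "0 \<le> K * b ^ n" using K(1) b by simp
  then show ?thesis using drift_pow_strong[of n x] unfolding right_diff_distrib by simp
qed

lemma drift_pow_le: "mat_vec (mat_pow Q n) V x \<le> (1 + K) * V x"
proof -
  have "b ^ n * V x \<le> 1 * V x" using b V_nonneg by (intro mult_right_mono power_le_one) auto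
  moreover have "K * 1 \<le> K * V x" using K(1) V_ge_1 by (intro mult_left_mono) auto
  ultimately show ?thesis using drift_pow[of n x] by (simp add: distrib_right)
qed

text \<open>The chain started in a sublevel set of \<^term>\<open>V\<close> hits \<^term>\<open>C\<close> before a fixed time with
  probability at least \<open>1 - b ^ n * V x\<close>, and from \<^term>\<open>C\<close> a fixed state is reached at
  every later time.\<close>

lemma minorization:
  obtains N \<delta> z where "0 < N" "0 < \<delta>" "\<And>x. V x \<le> R \<Longrightarrow> \<delta> \<le> mat_pow Q N x z"
proof -
  \<comment> \<open>Any state will do, since irreducibility and aperiodicity make it reachable at
    all late times.\<close>
  define z :: 'x where "z = undefined"
  have "\<exists>M. \<forall>n\<ge>M. mat_pow Q n c z > 0" for c
    using eventually_positive[OF aperiodic] .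
  then obtain M0 where M0: "\<And>c n. n \<ge> M0 c \<Longrightarrow> mat_pow Q n c z > 0" by metis
  \<comment> \<open>The sum dominates each of the finitely many thresholds, and \<open>Suc\<close>
    makes the time positive.\<close>
  define M where "M = Suc (\<Sum>c\<in>C. M0 c)"
  have M: "mat_pow Q n c z > 0" if "n \<ge> M" "c \<in> C" for n c
  proof -
    have "M0 c \<le> (\<Sum>c\<in>C. M0 c)" using C that by (intro member_le_sum) auto
    then show ?thesis using that unfolding M_def by (intro M0) auto
  qed
  \<comment> \<open>Chosen so that \<open>b ^ n0 * V x\<close> is at most one half whenever
    \<open>V x \<le> R\<close>, whatever the sign of \<open>R\<close>.\<close>
  obtain n0 where n0: "b ^ n0 < 1 / (2 * (\<bar>R\<bar> + 1))"
    using real_arch_pow_inv[of "1 / (2 * (\<bar>R\<bar> + 1))" b] b by (auto simp: add_nonneg_pos)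
  \<comment> \<open>A hit of \<open>C\<close> during the first \<open>n0\<close> steps leaves
    between \<open>M\<close> and \<open>M + n0\<close> steps, hence the range of \<open>j\<close>.
    The extra element 1 keeps the set nonempty even if \<open>C\<close> is empty.\<close>
  let ?S = "insert 1 ((\<lambda>(j,c). mat_pow Q j c z) ` ({M..M+n0} \<times> C))"
  define \<delta> where "\<delta> = Min ?S"
  have fin: "finite ?S" using C by auto
  have \<delta>: "0 < \<delta>" unfolding \<delta>_def using fin M by (subst Min_gr_iff) auto
  have \<delta>_le: "\<delta> \<le> mat_pow Q j c z" if "M \<le> j" "j \<le> M + n0" "c \<in> C" for j c
    unfolding \<delta>_def by (rule Min_le[OF fin]) (use that in force)
  \<comment> \<open>An induction on the remaining time replaces hitting times. At
    \<open>n = 0\<close> the left side is not positive; on \<open>C\<close> the right side is at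
    least \<delta>; off \<open>C\<close> the drift has no additive term, so one step turns
    \<open>b ^ n * V\<close> into at most \<open>b ^ Suc n * V x\<close>.\<close>
  have hit: "\<delta> * (1 - b ^ n * V x) \<le> mat_pow Q (n + M) x z" if "n \<le> n0" for n x
    using that
  proof (induction n arbitrary: x)
    case 0
    have "\<delta> * (1 - V x) \<le> 0" using \<delta> V_ge_1[of x] by (intro mult_nonneg_nonpos) auto
    also have "0 \<le> mat_pow Q M x z" by (rule finite_chain.nonneg[OF finite_chain_mat_pow])
    finally show ?case by simp
  next
    case (Suc n)
    show ?case
    proof (cases "x \<in> C")
      case True
      have "\<delta> * (1 - b ^ Suc n * V x) \<le> \<delta> * 1"
        using \<delta> b V_nonneg by (intro mult_left_mono) auto
      also have "\<dots> \<le> mat_pow Q (Suc n + M) x z" using \<delta>_le[of "Suc n + M" x] Suc.prems True by simp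
      finally show ?thesis .
    next
      case False
      have "b ^ n * mat_vec Q V x \<le> b ^ n * (b * V x)"
        using drift[of x] False b by (intro mult_left_mono) auto
      then have "\<delta> * (1 - b ^ Suc n * V x) \<le> \<delta> * (1 - b ^ n * mat_vec Q V x)"
        using \<delta> by (intro mult_left_mono) (auto simp: mult_ac)
      also have "\<dots> = mat_vec Q (\<lambda>y. \<delta> * (1 - b ^ n * V y)) x"
        by (simp add: mat_vec_diff mat_vec_cmult row_finite mat_vec_const)
      also have "\<dots> \<le> mat_vec Q (\<lambda>y. mat_pow Q (n + M) y z) x"
        by (rule mat_vec_mono) (use Suc in auto)
      also have "\<dots> = mat_pow Q (Suc n + M) x z" by (simp add: mat_mult_eq_mat_vec)
      finally show ?thesis .
    qed
  qed
  show ?thesis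
  proof (rule that[of "n0 + M" "\<delta> / 2" z])
    show "0 < n0 + M" by (simp add: M_def)
    show "0 < \<delta> / 2" using \<delta> by simp
    fix x assume "V x \<le> R"
    then have "b ^ n0 * V x \<le> 1 / (2 * (\<bar>R\<bar> + 1)) * (\<bar>R\<bar> + 1)"
      using n0 b V_nonneg by (intro mult_mono) auto
    also have "\<dots> = 1 / 2" by (simp add: field_simps)
    finally have "\<delta> * (1 / 2) \<le> \<delta> * (1 - b ^ n0 * V x)"
      using \<delta> by (intro mult_left_mono) auto
    then show "\<delta> / 2 \<le> mat_pow Q (n0 + M) x z" using hit[of n0 x] by simp
  qed
qed

text \<open>Pairs with \<open>V x + V y \<le> R\<close> profit from the minorization, all others
  from the drift. The weight \<beta> is small enough for the minorization to outweigh the growth of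
  the \<open>V\<close> part on the former, and \<epsilon> is a gain available in both cases.\<close>

lemma contraction:
  obtains N \<beta> \<alpha> where "0 < N" "0 < \<beta>" "0 < \<alpha>" "\<alpha> < 1"
    "\<forall>f m x y. 0 \<le> m \<longrightarrow> (\<forall>u v. \<bar>f u - f v\<bar> \<le> m * (2 + \<beta> * (V u + V v))) \<longrightarrow>
      \<bar>mat_vec (mat_pow Q N) f x - mat_vec (mat_pow Q N) f y\<bar> \<le> \<alpha> * m * (2 + \<beta> * (V x + V y))"
proof -
  \<comment> \<open>Beyond this level the additive \<open>2 * K\<close> uses up at most half of the
    decrease provided by the drift; the summand 1 keeps \<open>R\<close> positive when
    \<open>K\<close> is zero.\<close>
  define R where "R = 4 * K / (1 - b) + 1"
  have "(1 - b) * R = 4 * K + (1 - b)"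
    using b by (simp add: R_def distrib_left)
  then have R: "0 < R" "2 * K \<le> (1 - b) * R / 2"
    using K(1) b by (auto simp: R_def add_nonneg_pos)
  obtain N \<delta> z where N: "0 < N" "0 < \<delta>" "\<And>x. V x \<le> R \<Longrightarrow> \<delta> \<le> mat_pow Q N x z"
    using minorization by blast
  interpret N: finite_chain "mat_pow Q N" by (rule finite_chain_mat_pow)
  \<comment> \<open>With this choice the \<open>V\<close> part of a near pair costs at most
    \<open>\<beta> * R = \<delta>\<close>, half of the \<open>2 * \<delta>\<close> that minorization
    gains.\<close>
  define \<beta> where "\<beta> = \<delta> / R"
  \<comment> \<open>The solution of \<open>\<epsilon> * (2 + t) = (1 - b) / 2 * t\<close> at
    \<open>t = \<delta>\<close>. For larger t the left side is the smaller one, which settles far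
    pairs; near pairs only need \<open>2 * \<epsilon> \<le> \<delta>\<close>.\<close>
  define \<epsilon> where "\<epsilon> = (1 - b) * \<delta> / (2 * (2 + \<delta>))"
  have \<beta>: "0 < \<beta>" "\<beta> * R = \<delta>" using N R by (auto simp: \<beta>_def)
  have \<epsilon>: "0 < \<epsilon>" "\<epsilon> < 1" "2 * \<epsilon> \<le> \<delta>" "\<epsilon> * (2 * (2 + \<delta>)) = (1 - b) * \<delta>"
  proof -
    show 1: "0 < \<epsilon>" using N b by (auto simp: \<epsilon>_def)
    show 2: "\<epsilon> * (2 * (2 + \<delta>)) = (1 - b) * \<delta>" using N by (auto simp: \<epsilon>_def)
    have bd: "0 < b * \<delta>" using b N by simp
    have 4: "0 < \<epsilon> * \<delta>" using 1 N by simp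
    show "2 * \<epsilon> \<le> \<delta>" using 2 bd 4 1 unfolding distrib_left left_diff_distrib by linarith
    have "(1 - b) * \<delta> < 2 * (2 + \<delta>)"
      unfolding left_diff_distrib using bd \<open>0 < \<delta>\<close> by simp
    then have "\<epsilon> * (2 * (2 + \<delta>)) < 1 * (2 * (2 + \<delta>))" unfolding 2 by simp
    then show "\<epsilon> < 1" using N by (simp add: mult_less_cancel_right)
  qed
  have QV: "mat_vec (mat_pow Q N) V x \<le> b * V x + K" for x
  proof -
    have "b ^ N * V x \<le> b * V x"
      using b N V_nonneg power_decreasing[of 1 N b] by (intro mult_right_mono) auto
    then show ?thesis using drift_pow[of N x] by linarith
  qed
  show ?thesis
  proof (rule that[of N \<beta> "1 - \<epsilon>"]; (intro allI impI)?)
    fix f m x y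
    assume m: "0 \<le> m" and f: "\<forall>u v. \<bar>f u - f v\<bar> \<le> m * (2 + \<beta> * (V u + V v))"
    \<comment> \<open>One half of the symmetric weight, so that the oscillation hypothesis reads
      \<open>W u + W v\<close>.\<close>
    define W where "W u = m * (1 + \<beta> * V u)" for u
    let ?s = "V x + V y"
    have osc: "\<bar>f u - f v\<bar> \<le> W u + W v" for u v
      using f[rule_format, of u v] by (simp add: W_def algebra_simps)
    have QW: "mat_vec (mat_pow Q N) W x = m * (1 + \<beta> * mat_vec (mat_pow Q N) V x)" for x
      unfolding W_def by (simp add: mat_vec_cmult mat_vec_add N.row_finite N.mat_vec_const)
    have sum: "mat_vec (mat_pow Q N) W x + mat_vec (mat_pow Q N) W y \<le> m * (2 + \<beta> * (b * ?s + 2 * K))"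
    proof -
      have "m * (2 + \<beta> * (mat_vec (mat_pow Q N) V x + mat_vec (mat_pow Q N) V y)) \<le> m * (2 + \<beta> * (b * ?s + 2 * K))"
        using m \<beta> QV[of x] QV[of y]
        by (intro mult_left_mono add_left_mono) (auto simp: distrib_left)
      then show ?thesis unfolding QW by (simp add: algebra_simps)
    qed
    show "\<bar>mat_vec (mat_pow Q N) f x - mat_vec (mat_pow Q N) f y\<bar> \<le> (1 - \<epsilon>) * m * (2 + \<beta> * ?s)"
    proof (cases "?s \<le> R")
      case True
      then have "V x \<le> R" "V y \<le> R" using V_nonneg[of x] V_nonneg[of y] by linarith+
      then have "\<bar>mat_vec (mat_pow Q N) f x - mat_vec (mat_pow Q N) f y\<bar>
          \<le> mat_vec (mat_pow Q N) W x + mat_vec (mat_pow Q N) W y - 2 * \<delta> * W z"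
        by (intro N.oscillation_minorized osc N)
      also have "\<dots> \<le> m * (2 + \<beta> * R) - 2 * \<delta> * m"
      proof -
        have "b * ?s + 2 * K \<le> b * R + (1 - b) * R / 2" using True R b by (intro add_mono mult_left_mono) auto
        also have "\<dots> \<le> R" using R b by (simp add: field_simps)
        finally have "m * (2 + \<beta> * (b * ?s + 2 * K)) \<le> m * (2 + \<beta> * R)"
          using m \<beta> by (intro mult_left_mono add_left_mono) auto
        moreover have "m * 1 \<le> W z" unfolding W_def using m \<beta> V_nonneg by (intro mult_left_mono) auto
        then have "2 * \<delta> * m \<le> 2 * \<delta> * W z" using N by simp
        ultimately show ?thesis using sum by linarith
      qed
      also have "\<dots> = m * (2 - \<delta>)" unfolding \<beta> by (simp add: algebra_simps)
      also have "\<dots> \<le> m * ((1 - \<epsilon>) * 2)" using m \<epsilon> by (intro mult_left_mono) auto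
      also have "\<dots> \<le> m * ((1 - \<epsilon>) * (2 + \<beta> * ?s))"
        using m \<epsilon> \<beta> V_nonneg by (intro mult_left_mono) auto
      finally show ?thesis by (simp add: mult_ac)
    next
      case False
      have "\<bar>mat_vec (mat_pow Q N) f x - mat_vec (mat_pow Q N) f y\<bar>
          \<le> mat_vec (mat_pow Q N) W x + mat_vec (mat_pow Q N) W y"
        \<comment> \<open>Minorization with constant 0 is plain averaging; for far pairs the whole
          gain comes from the drift.\<close>
        using N.oscillation_minorized[of f W 0 x z y] osc N.nonneg by simp
      also have "\<dots> \<le> m * (2 + \<beta> * (b * ?s + 2 * K))" by (rule sum)
      also have "\<dots> \<le> m * ((1 - \<epsilon>) * (2 + \<beta> * ?s))"
      proof (rule mult_left_mono[OF _ m])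
        have t: "\<delta> \<le> \<beta> * ?s" using False \<beta> by (metis less_eq_real_def mult_left_mono not_le)
        have "2 * K \<le> (1 - b) * ?s / 2"
          using R(2) False b mult_left_mono[of R ?s "1 - b"] by linarith
        then have "\<beta> * (b * ?s + 2 * K) \<le> \<beta> * (b * ?s + (1 - b) * ?s / 2)"
          using \<beta> by (intro mult_left_mono) auto
        also have "\<dots> = \<beta> * ?s - (1 - b) / 2 * (\<beta> * ?s)" by (simp add: field_simps)
        finally have *: "\<beta> * (b * ?s + 2 * K) \<le> \<beta> * ?s - (1 - b) / 2 * (\<beta> * ?s)" .
        have "\<delta> * (\<epsilon> * (2 + \<beta> * ?s)) \<le> \<epsilon> * ((2 + \<delta>) * (\<beta> * ?s))"
          using mult_left_mono[OF t, of "2 * \<epsilon>"] \<epsilon> by (simp add: algebra_simps)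
        also have "\<dots> = \<delta> * ((1 - b) / 2 * (\<beta> * ?s))" using \<epsilon>(4) by algebra
        finally have "\<epsilon> * (2 + \<beta> * ?s) \<le> (1 - b) / 2 * (\<beta> * ?s)"
          using N(2) by (rule mult_left_le_imp_le)
        moreover have "2 + A \<le> 1 * (2 + B) - E" if "A \<le> B - D" "E \<le> D" for A B D E :: real
          using that by simp
        ultimately show "2 + \<beta> * (b * ?s + 2 * K) \<le> (1 - \<epsilon>) * (2 + \<beta> * ?s)"
          using * unfolding left_diff_distrib[of 1] by blast
      qed
      finally show ?thesis by (simp add: mult_ac)
    qed
  qed (use N \<beta> \<epsilon> in auto)
qed

lemma geometric_oscillation:
  obtains c r where "0 \<le> c" "0 < r" "r < 1"
    "\<forall>f n x y. (\<forall>u. \<bar>f u\<bar> \<le> V u) \<longrightarrow>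
      \<bar>mat_vec (mat_pow Q n) f x - mat_vec (mat_pow Q n) f y\<bar> \<le> c * r ^ n * (V x + V y)"
proof -
  obtain N \<beta> \<alpha> where N: "0 < N" "0 < \<beta>" "0 < \<alpha>" "\<alpha> < 1"
    and contr: "\<forall>f m x y. 0 \<le> m \<longrightarrow> (\<forall>u v. \<bar>f u - f v\<bar> \<le> m * (2 + \<beta> * (V u + V v))) \<longrightarrow>
      \<bar>mat_vec (mat_pow Q N) f x - mat_vec (mat_pow Q N) f y\<bar> \<le> \<alpha> * m * (2 + \<beta> * (V x + V y))"
    by (rule contraction)
  \<comment> \<open>The contraction acts once in \<open>N\<close> steps, so the rate per step is the
    \<open>N\<close>-th root. An incomplete block costs a factor of at most
    \<open>1 / \<alpha>\<close>.\<close>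
  define r where "r = root N \<alpha>"
  have r: "0 < r" "r < 1" "r ^ N = \<alpha>" using N by (auto simp: r_def)
  \<comment> \<open>Makes \<open>m * \<beta>\<close> equal to the uniform bound \<open>1 + K\<close>
    on the powers in the \<open>V\<close>-norm, which absorbs the leftover \<open>s < N\<close>
    steps before the contraction is iterated.\<close>
  define m where "m = (1 + K) / \<beta>"
  have m: "0 \<le> m" "m * \<beta> = 1 + K" using K(1) N by (auto simp: m_def)
  show ?thesis
  proof (rule that[of "m * (1 + \<beta>) / \<alpha>" r]; (intro allI impI)?)
    fix f n x y assume f: "\<forall>u. \<bar>f u\<bar> \<le> V u"
    define q s where "q = n div N" and "s = n mod N"
    define g where "g = mat_vec (mat_pow Q s) f"
    have g: "\<bar>g u\<bar> \<le> m * \<beta> * V u" for u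
    proof -
      interpret s: finite_chain "mat_pow Q s" by (rule finite_chain_mat_pow)
      have "\<bar>g u\<bar> \<le> mat_vec (mat_pow Q s) (\<lambda>y. \<bar>f y\<bar>) u" unfolding g_def by (rule s.mat_vec_abs)
      also have "\<dots> \<le> mat_vec (mat_pow Q s) V u" by (rule s.mat_vec_mono) (rule f[rule_format])
      also have "\<dots> \<le> (1 + K) * V u" by (rule drift_pow_le)
      finally show ?thesis unfolding m .
    qed
    have iter: "\<bar>mat_vec (mat_pow Q (k * N)) g x - mat_vec (mat_pow Q (k * N)) g y\<bar>
        \<le> \<alpha> ^ k * m * (2 + \<beta> * (V x + V y))" for k x y
    proof (induction k arbitrary: x y)
      case 0
      have "\<bar>g x - g y\<bar> \<le> m * \<beta> * V x + m * \<beta> * V y" using g[of x] g[of y] by linarith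
      then show ?case using m by (simp add: mat_vec_mat_one algebra_simps)
    next
      case (Suc k)
      have "mat_vec (mat_pow Q (Suc k * N)) g x = mat_vec (mat_pow Q N) (mat_vec (mat_pow Q (k * N)) g) x" for x
        by (simp add: mat_vec_pow_add row_finite)
      then show ?case
        using contr[rule_format, of "\<alpha> ^ k * m", OF _ Suc.IH, of x y] m N by (simp add: mult_ac)
    qed
    have n: "n = q * N + s" by (simp add: q_def s_def)
    have "mat_vec (mat_pow Q n) f x = mat_vec (mat_pow Q (q * N)) g x" for x
      unfolding n g_def by (rule mat_vec_pow_add[OF row_finite])
    then have "\<bar>mat_vec (mat_pow Q n) f x - mat_vec (mat_pow Q n) f y\<bar> \<le> \<alpha> ^ q * m * (2 + \<beta> * (V x + V y))"
      using iter by simp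
    also have "\<dots> \<le> r ^ n / \<alpha> * m * ((1 + \<beta>) * (V x + V y))"
    proof (intro mult_mono)
      have "r ^ N \<le> r ^ s" using r N by (intro power_decreasing) (auto simp: s_def less_imp_le)
      then have "\<alpha> ^ q * \<alpha> \<le> \<alpha> ^ q * r ^ s" using r N by (intro mult_left_mono) auto
      also have "\<dots> = r ^ n" unfolding n r(3)[symmetric] by (simp add: power_add power_mult mult.commute)
      finally show "\<alpha> ^ q \<le> r ^ n / \<alpha>" using N by (simp add: field_simps)
      show "2 + \<beta> * (V x + V y) \<le> (1 + \<beta>) * (V x + V y)"
        using V_ge_1[of x] V_ge_1[of y] by (simp add: distrib_right)
    qed (use m N r V_nonneg in auto)
    finally show "\<bar>mat_vec (mat_pow Q n) f x - mat_vec (mat_pow Q n) f y\<bar> \<le> m * (1 + \<beta>) / \<alpha> * r ^ n * (V x + V y)"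
      by (simp add: field_simps)
  qed (use m N r in auto)
qed

lemma geometric_ergodicity:
  obtains \<mu> c r where "stationary_for Q \<mu>" "0 \<le> c" "0 < r" "r < 1"
    "\<And>n x. wbound V (\<lambda>y. mat_pow Q n x y - pmf \<mu> y) (c * r ^ n * V x)"
proof -
  obtain c0 r where c0: "0 \<le> c0" and r: "0 < r" "r < 1"
    and osc': "\<forall>f n x y. (\<forall>u. \<bar>f u\<bar> \<le> V u) \<longrightarrow>
      \<bar>mat_vec (mat_pow Q n) f x - mat_vec (mat_pow Q n) f y\<bar> \<le> c0 * r ^ n * (V x + V y)"
    by (rule geometric_oscillation)
  have osc: "\<bar>mat_vec (mat_pow Q n) f x - mat_vec (mat_pow Q n) f y\<bar> \<le> c0 * r ^ n * (V x + V y)"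
    if "\<And>u. \<bar>f u\<bar> \<le> V u" for f n x y
    using osc' that by blast
  \<comment> \<open>Averaging \<open>V u + V x\<close> over \<open>k\<close> steps costs
    \<open>1 + K\<close> for the first summand and 1 for the second.\<close>
  define c where "c = c0 * (2 + K)"
  have c: "0 \<le> c" using c0 K(1) by (simp add: c_def)
  have diff: "\<bar>mat_vec (mat_pow Q (n + k)) f x - mat_vec (mat_pow Q n) f x\<bar> \<le> c * r ^ n * V x"
    if f: "\<And>u. \<bar>f u\<bar> \<le> V u" for n k f x
  proof -
    interpret k: finite_chain "mat_pow Q k" by (rule finite_chain_mat_pow)
    let ?g = "mat_vec (mat_pow Q n) f"
    \<comment> \<open>Running \<open>k\<close> steps first expresses the difference as an average of
      oscillations of the \<open>n\<close>-step function, which are small uniformly in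
      \<open>k\<close>. This makes the sequence Cauchy before any limit is known.\<close>
    have "mat_vec (mat_pow Q (n + k)) f x - ?g x = mat_vec (mat_pow Q k) (\<lambda>u. ?g u - ?g x) x"
      using mat_vec_pow_add[OF row_finite, of k n f x]
      by (simp add: add.commute mat_vec_diff k.row_finite k.mat_vec_const)
    then have "\<bar>mat_vec (mat_pow Q (n + k)) f x - ?g x\<bar> \<le> mat_vec (mat_pow Q k) (\<lambda>u. \<bar>?g u - ?g x\<bar>) x"
      by (simp only: k.mat_vec_abs)
    also have "\<dots> \<le> mat_vec (mat_pow Q k) (\<lambda>u. c0 * r ^ n * (V u + V x)) x"
      by (rule k.mat_vec_mono) (rule osc[OF f])
    also have "\<dots> = c0 * r ^ n * (mat_vec (mat_pow Q k) V x + V x)"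
      by (simp add: mat_vec_cmult mat_vec_add k.row_finite k.mat_vec_const)
    also have "\<dots> \<le> c0 * r ^ n * ((1 + K) * V x + V x)"
      using drift_pow_le[of k x] c0 r by (intro mult_left_mono) auto
    also have "\<dots> = c * r ^ n * V x" by (simp add: c_def algebra_simps)
    finally show ?thesis .
  qed
  have wb: "wbound V (\<lambda>y. mat_pow Q (n + k) x y - mat_pow Q n x y) (c * r ^ n * V x)" for n k x
  proof (rule wboundI)
    fix F :: "'x set" assume F: "finite F"
    let ?D = "\<lambda>y. mat_pow Q (n + k) x y - mat_pow Q n x y"
    \<comment> \<open>The test function that attains the weighted l1 norm of the difference over
      \<open>F\<close>.\<close>
    define f where "f y = (if y \<in> F then sgn (?D y) * V y else 0)" for y
    have f: "\<bar>f y\<bar> \<le> V y" for y using V_nonneg[of y] by (auto simp: f_def abs_mult sgn_if)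
    let ?A = "F \<union> {y. mat_pow Q (n + k) x y \<noteq> 0} \<union> {y. mat_pow Q n x y \<noteq> 0}"
    have A: "finite ?A" using F row_finite_mat_pow[OF row_finite] by (auto simp: row_finite_def)
    have "(\<Sum>y\<in>F. \<bar>?D y\<bar> * V y) = (\<Sum>y\<in>F. ?D y * f y)"
      by (intro sum.cong refl) (simp add: f_def abs_sgn)
    also have "\<dots> = (\<Sum>y\<in>?A. ?D y * f y)"
      by (rule sum.mono_neutral_left[OF A]) (auto simp: f_def)
    also have "\<dots> = mat_vec (mat_pow Q (n + k)) f x - mat_vec (mat_pow Q n) f x"
      using mat_vec_superset[OF A, of "mat_pow Q (n + k)" x f] mat_vec_superset[OF A, of "mat_pow Q n" x f]
      by (simp add: left_diff_distrib sum_subtractf)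
    also have "\<dots> \<le> c * r ^ n * V x" using diff[of f, OF f, of n k x] by linarith
    finally show "(\<Sum>y\<in>F. \<bar>?D y\<bar> * V y) \<le> c * r ^ n * V x" .
  qed
  define x0 :: 'x where "x0 = undefined"
  have "\<bar>mat_pow Q (n + k) x y - mat_pow Q n x y\<bar> \<le> c * r ^ n * V x" for n k x y
    using wbound_point[OF wb[of n k x], of y] mult_left_mono[OF V_ge_1[of y], of "\<bar>mat_pow Q (n + k) x y - mat_pow Q n x y\<bar>"]
    by simp
  then have "convergent (\<lambda>n. mat_pow Q n x y)" for x y
    using r by (intro convergent_geometric[of r _ "c * V x"]) (auto simp: mult_ac)
  then obtain p where p0: "\<And>y. (\<lambda>n. mat_pow Q n x0 y) \<longlonglongrightarrow> p y" unfolding convergent_def by metis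
  \<comment> \<open>Column indicators are bounded by \<open>V\<close> because \<open>V\<close> is at
    least 1, so the oscillation bound makes the limit independent of the starting state.\<close>
  have p: "(\<lambda>n. mat_pow Q n x y) \<longlonglongrightarrow> p y" for x y
  proof -
    have "\<bar>mat_one u y\<bar> \<le> V u" for u using V_ge_1[of u] by (auto simp: mat_one_def)
    from osc[OF this] have le: "\<bar>mat_pow Q n x y - mat_pow Q n x0 y\<bar> \<le> c0 * r ^ n * (V x + V x0)" for n
      by (simp add: mat_vec_of_mat_one row_finite_mat_pow row_finite)
    have "(\<lambda>n. mat_pow Q n x y - mat_pow Q n x0 y) \<longlonglongrightarrow> 0"
      using r le by (rule geometric_null)
    from tendsto_add[OF this p0[of y]] show ?thesis by simp
  qed
  have wbp: "wbound V (\<lambda>y. mat_pow Q n x y - p y) (c * r ^ n * V x)" for n x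
  proof (rule wboundI)
    fix F :: "'x set" assume F: "finite F"
    have "(\<lambda>k. \<Sum>y\<in>F. \<bar>mat_pow Q n x y - mat_pow Q (n + k) x y\<bar> * V y) \<longlonglongrightarrow> (\<Sum>y\<in>F. \<bar>mat_pow Q n x y - p y\<bar> * V y)"
      using LIMSEQ_ignore_initial_segment[OF p, of n] by (intro tendsto_intros) (simp add: add.commute)
    then show "(\<Sum>y\<in>F. \<bar>mat_pow Q n x y - p y\<bar> * V y) \<le> c * r ^ n * V x"
      by (rule LIMSEQ_le_const2) (use wboundD[OF wb F] in \<open>auto simp: abs_minus_commute\<close>)
  qed
  have lim: "(\<lambda>n. mat_vec (mat_pow Q n) f x) \<longlonglongrightarrow> (\<Sum>\<^sub>\<infinity>y. p y * f y)" and ps: "(\<lambda>y. p y * f y) summable_on UNIV"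
    if f: "\<And>u. \<bar>f u\<bar> \<le> V u" for f x
    using mat_vec_pow_tendsto[OF V_nonneg r wbp, of 1 f] f by auto
  have one: "\<And>u. \<bar>(\<lambda>_. 1) u\<bar> \<le> V u" using V_ge_1 by simp
  have "(\<lambda>n. mat_vec (mat_pow Q n) (\<lambda>_. 1) x0) = (\<lambda>_. 1)"
    by (simp add: finite_chain.mat_vec_one[OF finite_chain_mat_pow])
  then have sum1: "(\<Sum>\<^sub>\<infinity>y. p y) = 1"
    using LIMSEQ_unique[OF lim[OF one, of x0], of 1] by simp
  have p_nonneg: "0 \<le> p y" for y
    by (rule LIMSEQ_le_const[OF p0]) (use finite_chain.nonneg[OF finite_chain_mat_pow] in auto)
  obtain \<mu> where \<mu>: "pmf \<mu> = p"
    by (rule pmf_of_infsum[of p]) (use ps[OF one] sum1 p_nonneg in auto)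
  have "vec_mat p Q y = p y" for y
  proof -
    \<comment> \<open>Invariance follows by taking a column of \<open>Q\<close> as the test
      function: its averages are the entries of the next power, with the same limit
      \<open>p y\<close>.\<close>
    have "\<bar>Q u y\<bar> \<le> V u" for u using nonneg[of u y] entry_le_one[of u y] V_ge_1[of u] by simp
    from lim[OF this, of x0] have "(\<lambda>n. mat_vec (mat_pow Q n) (\<lambda>u. Q u y) x0) \<longlonglongrightarrow> vec_mat p Q y"
      by (simp add: vec_mat_def)
    moreover have "mat_vec (mat_pow Q n) (\<lambda>u. Q u y) x0 = mat_pow Q (n + 1) x0 y" for n
      using mat_pow_add[OF row_finite, of n 1] mat_vec_of_mat_one[OF row_finite]
      by (simp add: mat_mult_eq_mat_vec)
    ultimately have "(\<lambda>n. mat_pow Q (n + 1) x0 y) \<longlonglongrightarrow> vec_mat p Q y" by simp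
    then show ?thesis using LIMSEQ_unique LIMSEQ_ignore_initial_segment[OF p0[of y], of 1] by blast
  qed
  then have "stationary_for Q \<mu>" by (simp add: stationary_for_iff_vec_mat \<mu> fun_eq_iff)
  then show ?thesis using that[of \<mu> c r] c r wbp \<mu> by simp
qed

end

section \<open>The fundamental matrix\<close>

lemma infsum_ennreal:
  fixes f :: "'x \<Rightarrow> real"
  assumes "f summable_on UNIV" "\<And>x. 0 \<le> f x"
  shows "(\<Sum>\<^sub>\<infinity>x. ennreal (f x)) = ennreal (infsum f UNIV)"
  using assms by (simp add: infsum_nonneg_is_SUPREMUM_ennreal nonneg_infsum_complete sum_ennreal)

lemma mat_vnorm_le:
  assumes V: "\<And>x. 1 \<le> V x" and k: "0 \<le> k" and M: "\<And>x. wbound V (M x) (k * V x)"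
  shows "mat_vnorm V M \<le> ennreal k"
  unfolding mat_vnorm_def
proof (rule SUP_least)
  fix x
  have V0: "0 \<le> V y" "0 < V y" for y using V[of y] by linarith+
  note w = wbound_abs_summable[of V, OF V0(1) M[of x]]
  have "(\<Sum>\<^sub>\<infinity>y. ennreal (\<bar>M x y\<bar> * V y)) = ennreal (\<Sum>\<^sub>\<infinity>y. \<bar>M x y\<bar> * V y)"
    by (rule infsum_ennreal[OF w(1)]) (use V0 in auto)
  also have "\<dots> / ennreal (V x) = ennreal ((\<Sum>\<^sub>\<infinity>y. \<bar>M x y\<bar> * V y) / V x)"
    by (rule divide_ennreal) (use V0 in \<open>auto intro: infsum_nonneg\<close>)
  also have "\<dots> \<le> ennreal k"
    using w(2) V0(2)[of x] by (intro ennreal_leI) (simp add: divide_le_eq)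
  finally show "(\<Sum>\<^sub>\<infinity>y. ennreal (\<bar>M x y\<bar> * V y)) / ennreal (V x) \<le> ennreal k" .
qed

lemma wbound_mat_vnorm:
  assumes V: "\<And>x. 1 \<le> V x" and k: "0 \<le> k" and M: "mat_vnorm V M \<le> ennreal k"
  shows "wbound V (M x) (k * V x)"
proof (rule wboundI)
  fix F :: "'a set" assume F: "finite F"
  have V0: "0 \<le> V y" "0 < V y" for y using V[of y] by linarith+
  let ?S = "\<Sum>\<^sub>\<infinity>y. ennreal (\<bar>M x y\<bar> * V y)"
  have "ennreal (\<Sum>y\<in>F. \<bar>M x y\<bar> * V y) = (\<Sum>y\<in>F. ennreal (\<bar>M x y\<bar> * V y))"
    using V0 by (intro sum_ennreal[symmetric]) auto
  also have "\<dots> \<le> ?S" 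
    by (subst nonneg_infsum_complete) (use F in \<open>auto intro: SUP_upper\<close>)
  also have "?S = ?S / ennreal (V x) * ennreal (V x)"
    using V0[of x] by (simp add: ennreal_divide_times ennreal_mult_divide_eq)
  also have "\<dots> \<le> ennreal k * ennreal (V x)"
  proof (rule mult_right_mono)
    have "?S / ennreal (V x) \<le> mat_vnorm V M" unfolding mat_vnorm_def by (rule SUP_upper) simp
    then show "?S / ennreal (V x) \<le> ennreal k" using M by (rule order_trans)
  qed simp
  also have "\<dots> = ennreal (k * V x)" using k V0 by (simp add: ennreal_mult)
  finally show "(\<Sum>y\<in>F. \<bar>M x y\<bar> * V y) \<le> k * V x"
    using k V0 by (subst (asm) ennreal_le_iff) auto
qed

lemma wbound_add_pair:
  assumes V: "\<And>y. 0 \<le> V y" and a: "wbound V a c" and a': "wbound V a' c'" and f: "0 \<le> k" "\<And>y. \<bar>f y\<bar> \<le> k * V y"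
  shows "(\<Sum>\<^sub>\<infinity>y. (a y + a' y) * f y) = (\<Sum>\<^sub>\<infinity>y. a y * f y) + (\<Sum>\<^sub>\<infinity>y. a' y * f y)"
  unfolding distrib_right
  by (rule infsum_add[OF wbound_pair(1)[OF V a f] wbound_pair(1)[OF V a' f]])

section \<open>Harmonic functions and uniqueness for the Poisson equation\<close>

context irreducible_finite_chain
begin

lemma stationary_pmf_pos:
  assumes "stationary_for Q \<mu>" shows "0 < pmf \<mu> x"
proof (rule ccontr)
  assume "\<not> 0 < pmf \<mu> x"
  then have 0: "pmf \<mu> x = 0" using pmf_nonneg[of \<mu> x] by linarith
  have "pmf \<mu> y = 0" for y
    by (rule nonneg_invariant_zero[OF pmf_summable pmf_nonneg _ 0])
       (use assms in \<open>simp add: stationary_for_iff_vec_mat\<close>)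
  then show False using infsum_pmf[of \<mu>] by simp
qed

lemma stationary_eq:
  assumes "stationary_for Q \<mu>" shows "stationary Q = \<mu>"
  unfolding stationary_def using assms stationary_for_unique by blast

text \<open>By stationarity and Fubini, \<open>mat_vec Q v\<close> and \<open>v\<close> have the
  same mean, so their nonnegative difference has mean zero; \<mu> charges every state.\<close>

lemma subharmonic_integrable_harmonic:
  assumes \<mu>: "stationary_for Q \<mu>" and v: "\<And>x. 0 \<le> v x" "\<And>x. v x \<le> mat_vec Q v x" "mean_summable \<mu> v"
  shows "mat_vec Q v x = v x"
proof -
  let ?F = "\<lambda>y x. pmf \<mu> x * Q x y * v y"
  have sQ: "(\<lambda>x. pmf \<mu> x * Q x y) summable_on UNIV" for y
    by (rule vec_mat_row_sum(1)[OF finite_chain_axioms pmf_summable])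
  have col: "(\<Sum>\<^sub>\<infinity>x. ?F y x) = pmf \<mu> y * v y" for y
    using infsum_cmult_left[of "v y" "\<lambda>x. pmf \<mu> x * Q x y", OF sQ] \<mu> by (simp add: stationary_for_def)
  have s: "?F y summable_on UNIV" for y by (rule summable_on_cmult_left[OF sQ])
  have s': "(\<lambda>y. \<Sum>\<^sub>\<infinity>x. \<bar>?F y x\<bar>) summable_on UNIV"
    using v by (simp add: abs_mult nonneg col mean_summable_def)
  have row: "(\<Sum>\<^sub>\<infinity>y. ?F y x) = pmf \<mu> x * mat_vec Q v x" for x
    unfolding mat_vec_def mult.assoc by (rule infsum_cmult_right[OF row_finite_summable[OF row_finite]])
  note sw = infsum_swap_abs[of ?F, OF s s', unfolded col row]
  have sv: "(\<lambda>x. - (pmf \<mu> x * v x)) summable_on UNIV" using v(3) by (simp add: mean_summable_def summable_on_uminus)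
  let ?d = "\<lambda>x. pmf \<mu> x * mat_vec Q v x + - (pmf \<mu> x * v x)"
  have "?d x = 0"
  proof (rule nonneg_infsum_le_0D[of ?d UNIV])
    show "infsum ?d UNIV \<le> 0"
      using infsum_add[OF sw(3) sv] sw(1) by (simp add: infsum_uminus)
    show "?d summable_on UNIV" by (rule summable_on_add[OF sw(3) sv])
    show "0 \<le> ?d y" for y using v(2)[of y] by (simp add: mult_left_mono)
  qed simp
  then show ?thesis using stationary_pmf_pos[OF \<mu>, of x] by simp
qed

text \<open>An integrable harmonic function is constant. The positive part of \<open>u - u y\<close>
  is subharmonic and integrable, hence harmonic; it vanishes at \<open>y\<close>, and since
  \<open>y\<close> leads to \<open>x\<close> with positive probability it vanishes at
  \<open>x\<close>.\<close>

lemma harmonic_le: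
  assumes \<mu>: "stationary_for Q \<mu>" and u: "\<And>x. mat_vec Q u x = u x" "mean_summable \<mu> (\<lambda>x. \<bar>u x\<bar>)"
  shows "u x \<le> u y"
proof (rule ccontr)
  assume less: "\<not> u x \<le> u y"
  define w where "w z = max (u z - u y) 0" for z
  have sub: "w z \<le> mat_vec Q w z" for z
  proof -
    have "u z - u y = mat_vec Q (\<lambda>z. u z - u y) z" by (simp add: mat_vec_diff row_finite mat_vec_const u)
    also have "\<dots> \<le> mat_vec Q w z" by (rule mat_vec_mono) (simp add: w_def)
    finally have "u z - u y \<le> mat_vec Q w z" .
    moreover have "0 \<le> mat_vec Q w z" using mat_vec_mono[of "\<lambda>_. 0" w z] by (simp add: mat_vec_const w_def)
    ultimately show ?thesis by (simp add: w_def)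
  qed
  have "(\<lambda>z. pmf \<mu> z * \<bar>u z\<bar> + pmf \<mu> z * \<bar>u y\<bar>) summable_on UNIV"
    using u(2) by (intro summable_on_add summable_on_cmult_left pmf_summable) (simp add: mean_summable_def)
  then have "(\<lambda>z. norm (pmf \<mu> z * w z)) summable_on UNIV"
  proof (rule Infinite_Sum.abs_summable_on_comparison_test')
    fix z
    have "\<bar>w z\<bar> \<le> \<bar>u z\<bar> + \<bar>u y\<bar>" by (auto simp: w_def)
    from mult_left_mono[OF this, of "pmf \<mu> z"]
    show "norm (pmf \<mu> z * w z) \<le> pmf \<mu> z * \<bar>u z\<bar> + pmf \<mu> z * \<bar>u y\<bar>" by (simp add: abs_mult distrib_left)
  qed
  then have "mean_summable \<mu> w" unfolding mean_summable_def by (rule abs_summable_summable)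
  then have Qw: "mat_vec Q w = w"
    by (intro ext subharmonic_integrable_harmonic[OF \<mu> _ sub]) (simp add: w_def)
  have "mat_vec (mat_pow Q n) w z = w z" for n z
  proof (induction n arbitrary: z)
    case 0
    show ?case by (simp add: mat_vec_mat_one)
  next
    case (Suc n)
    then have "mat_vec (mat_pow Q n) w = w" by auto
    then show ?case by (simp only: mat_vec_pow_Suc Qw)
  qed
  then have le: "mat_pow Q n y x * w x \<le> w y" for n
    using finite_chain.mat_vec_ge_entry[OF finite_chain_mat_pow, of w n y x] by (simp add: w_def)
  obtain n where n: "mat_pow Q n y x > 0" using irreducible by blast
  have "mat_pow Q n y x * w x \<le> 0" using le[of n] by (simp add: w_def)
  then have "w x \<le> 0" using n by (simp add: mult_le_0_iff)
  then show False using less by (simp add: w_def)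
qed

text \<open>The competitors are only \<mu>-integrable, so convergence in the \<open>V\<close>-norm
  says nothing about them. Their difference is harmonic, thus constant, and the normalization to
  mean zero removes the constant.\<close>

lemma poisson_solution_unique:
  assumes \<mu>: "stationary_for Q \<mu>" and h: "poisson_solution Q g h" "poisson_solution Q g h'"
  shows "h = h'"
proof -
  note st = stationary_eq[OF \<mu>]
  let ?u = "\<lambda>x. h x - h' x"
  have s: "(\<lambda>x. pmf \<mu> x * \<bar>h x\<bar>) summable_on UNIV" "(\<lambda>x. pmf \<mu> x * \<bar>h' x\<bar>) summable_on UNIV"
    using h by (auto simp: poisson_solution_def st mean_summable_def)
  have sh: "(\<lambda>x. pmf \<mu> x * h x) summable_on UNIV" "(\<lambda>x. - (pmf \<mu> x * h' x)) summable_on UNIV"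
    using s summable_on_iff_abs_summable_on_real[of "\<lambda>x. pmf \<mu> x * h x" UNIV]
      summable_on_iff_abs_summable_on_real[of "\<lambda>x. pmf \<mu> x * h' x" UNIV]
    by (simp_all add: abs_mult summable_on_uminus)
  have harm: "mat_vec Q ?u x = ?u x" for x
  proof -
    have "g x - mean \<mu> g + mat_vec Q h x - h x = 0" "g x - mean \<mu> g + mat_vec Q h' x - h' x = 0"
      using h by (simp_all add: poisson_solution_def st)
    then show ?thesis by (simp add: mat_vec_diff row_finite)
  qed
  have "(\<lambda>z. norm (pmf \<mu> z * \<bar>?u z\<bar>)) summable_on UNIV"
  proof (rule Infinite_Sum.abs_summable_on_comparison_test'[OF summable_on_add[OF s]])
    fix z
    have "pmf \<mu> z * \<bar>?u z\<bar> \<le> pmf \<mu> z * (\<bar>h z\<bar> + \<bar>h' z\<bar>)" by (intro mult_left_mono) auto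
    then show "norm (pmf \<mu> z * \<bar>?u z\<bar>) \<le> pmf \<mu> z * \<bar>h z\<bar> + pmf \<mu> z * \<bar>h' z\<bar>" by (simp add: distrib_left)
  qed
  then have "mean_summable \<mu> (\<lambda>x. \<bar>?u x\<bar>)" unfolding mean_summable_def by (rule abs_summable_summable)
  then have le: "?u x \<le> ?u y" for x y
    by (rule harmonic_le[of \<mu> ?u, OF \<mu> harm])
  then have const: "?u x = ?u y" for x y by (rule antisym) (rule le)
  have "(\<Sum>\<^sub>\<infinity>x. pmf \<mu> x * ?u x) = 0"
    using infsum_add[OF sh] h by (simp add: poisson_solution_def st mean_def infsum_uminus right_diff_distrib)
  moreover have "(\<Sum>\<^sub>\<infinity>x. pmf \<mu> x * ?u x) = ?u y" for y
  proof -
    have "(\<Sum>\<^sub>\<infinity>x. pmf \<mu> x * ?u x) = (\<Sum>\<^sub>\<infinity>x. pmf \<mu> x * ?u y)"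
    proof (rule infsum_cong)
      fix x show "pmf \<mu> x * ?u x = pmf \<mu> x * ?u y" by (simp only: const[of x y])
    qed
    also have "\<dots> = ?u y" by (subst infsum_cmult_left) (simp_all add: pmf_summable infsum_pmf)
    finally show ?thesis .
  qed
  ultimately have "?u y = 0" for y by (metis (no_types))
  then show ?thesis by (intro ext) simp
qed

end

text \<open>Retains from the drift only its outcome, a stationary distribution approached at a
  geometric rate in the \<open>V\<close>-norm.\<close>

locale ergodic_chain = irreducible_finite_chain Q for Q :: "'x \<Rightarrow> 'x \<Rightarrow> real" +
  fixes V :: "'x \<Rightarrow> real" and \<mu> :: "'x pmf" and c r :: real
  assumes V_ge_1: "1 \<le> V x" and stationary: "stationary_for Q \<mu>"
    and c: "0 \<le> c" and r: "0 < r" "r < 1"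
    and ergodic: "wbound V (\<lambda>y. mat_pow Q n x y - pmf \<mu> y) (c * r ^ n * V x)"
begin

lemma V_nonneg: "0 \<le> V x"
  using V_ge_1[of x] by linarith

lemmas stationary_Q = stationary_eq[OF stationary]

lemma wbound_mat_one: "wbound V (mat_one x) (V x)"
proof (rule wboundI)
  fix F :: "'x set" assume "finite F"
  then have "(\<Sum>y\<in>F. \<bar>mat_one x y\<bar> * V y) = (if x \<in> F then V x else 0)"
    by (simp add: mat_one_def if_distrib[of abs] if_distrib[of "\<lambda>t. t * _"] cong: if_cong)
  then show "(\<Sum>y\<in>F. \<bar>mat_one x y\<bar> * V y) \<le> V x" using V_nonneg by simp
qed

lemma V_summable: "(\<lambda>y. pmf \<mu> y * V y) summable_on UNIV"
  using mat_vec_pow_tendsto(1)[of V r "pmf \<mu>" c 1 V, OF V_nonneg r ergodic] V_nonneg by simp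

lemma wbound_stationary: "wbound V (pmf \<mu>) (mean \<mu> V)"
  by (rule wboundI_infsum[OF V_nonneg]) (use V_summable in \<open>simp_all add: mean_def\<close>)

lemma mean_summable_V_bounded:
  assumes "0 \<le> k" "\<And>y. \<bar>f y\<bar> \<le> k * V y"
  shows "mean_summable \<mu> f"
  unfolding mean_summable_def by (rule wbound_pair(1)[OF V_nonneg wbound_stationary assms])

lemma mat_vec_pow_tendsto_mean:
  assumes "0 \<le> k" "\<And>y. \<bar>f y\<bar> \<le> k * V y"
  shows "(\<lambda>n. mat_vec (mat_pow Q n) f x) \<longlonglongrightarrow> mean \<mu> f"
  unfolding mean_def by (rule mat_vec_pow_tendsto(2)[OF V_nonneg r ergodic assms])

text \<open>Boundedness of \<open>Q\<close> in the \<open>V\<close>-norm is recovered from the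
  ergodicity bound at time 1.\<close>

lemma wbound_row: "wbound V (Q x) ((c + mean \<mu> V) * V x)"
proof -
  have "wbound V (\<lambda>y. (mat_pow Q 1 x y - pmf \<mu> y) + pmf \<mu> y) (c * r ^ 1 * V x + mean \<mu> V)"
    by (rule wbound_add[OF V_nonneg ergodic wbound_stationary])
  also have "(\<lambda>y. (mat_pow Q 1 x y - pmf \<mu> y) + pmf \<mu> y) = Q x"
    using mat_vec_of_mat_one[OF row_finite, where x = x] by (simp add: mat_mult_eq_mat_vec)
  finally show ?thesis
  proof (rule wbound_mono)
    have "mean \<mu> V * 1 \<le> mean \<mu> V * V x"
      by (rule mult_left_mono[OF V_ge_1 wbound_nonneg[OF wbound_stationary]])
    moreover have "c * r * V x \<le> c * 1 * V x"
      using c r V_nonneg by (intro mult_right_mono mult_left_mono) auto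
    ultimately show "c * r ^ 1 * V x + mean \<mu> V \<le> (c + mean \<mu> V) * V x"
      by (simp add: distrib_right)
  qed
qed

lemma mat_vec_V_bounded:
  assumes "0 \<le> k" "\<And>y. \<bar>f y\<bar> \<le> k * V y"
  shows "\<bar>mat_vec Q f x\<bar> \<le> k * (c + mean \<mu> V) * V x"
  using wbound_pair(4)[OF V_nonneg wbound_row assms, of x] by (simp add: mat_vec_def mult.assoc)

text \<open>Both means are limits of the same sequence shifted by one step.\<close>

lemma mean_mat_vec:
  assumes "0 \<le> k" "\<And>y. \<bar>f y\<bar> \<le> k * V y"
  shows "mean \<mu> (mat_vec Q f) = mean \<mu> f"
proof -
  have lim: "(\<lambda>n. mat_vec (mat_pow Q n) (mat_vec Q f) undefined) \<longlonglongrightarrow> mean \<mu> (mat_vec Q f)"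
    by (rule mat_vec_pow_tendsto_mean[OF _ mat_vec_V_bounded[OF assms]])
       (use assms(1) wbound_nonneg[OF wbound_stationary] c in auto)
  moreover have "mat_vec (mat_pow Q n) (mat_vec Q f) x = mat_vec (mat_pow Q (n + 1)) f x" for n x
    using mat_vec_pow_Suc2[of n f x] by simp
  moreover have "(\<lambda>n. mat_vec (mat_pow Q (n + 1)) f x) \<longlonglongrightarrow> mean \<mu> f" for x
    by (rule LIMSEQ_ignore_initial_segment[OF mat_vec_pow_tendsto_mean[OF assms(1,2)]])
  ultimately have "(\<lambda>n. mat_vec (mat_pow Q n) (mat_vec Q f) undefined) \<longlonglongrightarrow> mean \<mu> f"
    by (simp only:)
  with lim show ?thesis by (rule LIMSEQ_unique)
qed

lemma mean_entry: "mean \<mu> (\<lambda>z. mat_pow Q n z y) = pmf \<mu> y"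
proof (induction n)
  case 0
  have "(\<Sum>\<^sub>\<infinity>z. pmf \<mu> z * mat_one z y) = (\<Sum>\<^sub>\<infinity>z\<in>{y}. pmf \<mu> z * mat_one z y)"
    by (rule infsum_cong_neutral) (auto simp: mat_one_def)
  then show ?case by (simp add: mean_def mat_one_def)
next
  case (Suc n)
  have le: "\<bar>mat_pow Q n z y\<bar> \<le> 1 * V z" for n z
    using V_ge_1[of z] finite_chain.nonneg[OF finite_chain_mat_pow, of n z y]
      finite_chain.entry_le_one[OF finite_chain_mat_pow, of n z y] by simp
  have "mean \<mu> (mat_vec Q (\<lambda>z. mat_pow Q n z y)) = mean \<mu> (\<lambda>z. mat_pow Q n z y)"
    by (rule mean_mat_vec[OF _ le[of n]]) simp
  then show ?case using Suc by (simp add: mat_mult_eq_mat_vec[abs_def])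
qed

text \<open>With \<Pi> the stationary matrix,
  \<open>Q \<Pi> = \<Pi> Q = \<Pi> \<Pi> = \<Pi>\<close>, so the mixed terms collapse. The exponent
  is a successor because the power at 0 is the identity, with nothing subtracted.\<close>

lemma mat_pow_deviation:
  "mat_pow (Q - stationary_matrix Q) (Suc n) x y = mat_pow Q (Suc n) x y - pmf \<mu> y"
proof (induction n arbitrary: x y)
  case 0
  have "(\<Sum>\<^sub>\<infinity>z. (Q x z - pmf \<mu> z) * mat_one z y) = (\<Sum>\<^sub>\<infinity>z\<in>{y}. (Q x z - pmf \<mu> z) * mat_one z y)"
    by (rule infsum_cong_neutral) (auto simp: mat_one_def)
  then show ?case
    using mat_vec_of_mat_one[OF row_finite, where x = x and y = y]
    by (simp add: mat_mult_def mat_vec_def stationary_matrix_def stationary_Q mat_one_def)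
next
  case (Suc n)
  let ?p = "\<lambda>z. mat_pow Q (Suc n) z y"
  have p: "\<bar>?p z\<bar> \<le> 1 * V z" "\<bar>pmf \<mu> y\<bar> \<le> 1 * V z" for z
    using V_ge_1[of z] finite_chain.nonneg[OF finite_chain_mat_pow, of "Suc n" z y]
      finite_chain.entry_le_one[OF finite_chain_mat_pow, of "Suc n" z y] pmf_le_1[of \<mu> y] by simp_all
  have s: "(\<lambda>z. Q x z * f z) summable_on UNIV" for f :: "'x \<Rightarrow> real"
    by (rule row_finite_summable[OF row_finite])
  have s': "(\<lambda>z. pmf \<mu> z * ?p z) summable_on UNIV"
    using mean_summable_V_bounded[of 1 ?p] p(1) by (simp add: mean_summable_def del: mat_pow.simps)
  have "mat_pow (Q - stationary_matrix Q) (Suc (Suc n)) x y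
      = (\<Sum>\<^sub>\<infinity>z. (Q x z - pmf \<mu> z) * (?p z - pmf \<mu> y))"
    unfolding mat_pow.simps(2)[of _ "Suc n"] mat_mult_def Suc
    by (simp add: stationary_matrix_def stationary_Q)
  also have "\<dots> = (\<Sum>\<^sub>\<infinity>z. (Q x z * (?p z - pmf \<mu> y) + - (pmf \<mu> z * ?p z)) + pmf \<mu> z * pmf \<mu> y)"
    by (simp add: algebra_simps)
  also have "\<dots> = (mat_vec Q (\<lambda>z. ?p z - pmf \<mu> y) x + - mean \<mu> ?p) + pmf \<mu> y"
  proof -
    have n: "(\<lambda>z. - (pmf \<mu> z * ?p z)) summable_on UNIV" using s' by (simp only: summable_on_uminus)
    have m: "(\<lambda>z. pmf \<mu> z * pmf \<mu> y) summable_on UNIV" by (rule summable_on_cmult_left[OF pmf_summable])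
    have "(\<Sum>\<^sub>\<infinity>z. pmf \<mu> z * pmf \<mu> y) = pmf \<mu> y"
      by (subst infsum_cmult_left) (simp_all add: pmf_summable infsum_pmf)
    then show ?thesis
      unfolding infsum_add[OF summable_on_add[OF s n] m] infsum_add[OF s n] infsum_uminus
      by (simp add: mat_vec_def mean_def)
  qed
  also have "\<dots> = mat_pow Q (Suc (Suc n)) x y - pmf \<mu> y"
    unfolding mean_entry by (simp only: mat_vec_diff[OF row_finite] mat_vec_const mat_pow.simps(2)[of _ "Suc n"] mat_mult_eq_mat_vec)
  finally show ?case .
qed

text \<open>The 1 in \<open>1 + c\<close> pays for the identity at exponent 0.\<close>

lemma wbound_deviation_pow: "wbound V (mat_pow (Q - stationary_matrix Q) n x) ((1 + c) * V x * r ^ n)"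
proof (cases n)
  case 0
  have "V x \<le> (1 + c) * V x" using c V_nonneg[of x] by (simp add: distrib_right)
  then show ?thesis using wbound_mono[OF wbound_mat_one] 0 by simp
next
  case (Suc m)
  have "c * r ^ n * V x \<le> (1 + c) * V x * r ^ n"
    using mult_nonneg_nonneg[OF V_nonneg[of x], of "r ^ n"] r by (simp add: algebra_simps)
  then have "wbound V (\<lambda>y. mat_pow Q n x y - pmf \<mu> y) ((1 + c) * V x * r ^ n)"
    by (rule wbound_mono[OF ergodic])
  also have "(\<lambda>y. mat_pow Q n x y - pmf \<mu> y) = mat_pow (Q - stationary_matrix Q) n x"
    unfolding Suc using mat_pow_deviation by auto
  finally show ?thesis .
qed

lemma fundamental_matrix_tail:
  "wbound V (\<lambda>y. fundamental_matrix Q x y - (\<Sum>k<n. mat_pow (Q - stationary_matrix Q) k x y))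
     ((1 + c) * V x * r ^ n / (1 - r))"
  unfolding fundamental_matrix_def
  by (rule wbound_series(2)[OF V_ge_1 _ _ wbound_deviation_pow]) (use r in auto)

lemma fundamental_matrix_converges:
  "(\<lambda>n. mat_vnorm V (\<lambda>x y. fundamental_matrix Q x y
      - (\<Sum>k<n. mat_pow (Q - stationary_matrix Q) k x y))) \<longlonglongrightarrow> 0"
proof -
  have le: "mat_vnorm V (\<lambda>x y. fundamental_matrix Q x y
      - (\<Sum>k<n. mat_pow (Q - stationary_matrix Q) k x y)) \<le> ennreal ((1 + c) / (1 - r) * r ^ n)" for n
    using c r fundamental_matrix_tail[of _ n]
    by (intro mat_vnorm_le V_ge_1) (simp_all add: field_simps)
  have "(\<lambda>n. (1 + c) / (1 - r) * r ^ n) \<longlonglongrightarrow> 0"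
    using LIMSEQ_power_zero[of r] r by (intro tendsto_mult_right_zero) auto
  from tendsto_ennrealI[OF this] have lim: "(\<lambda>n. ennreal ((1 + c) / (1 - r) * r ^ n)) \<longlonglongrightarrow> 0"
    by simp
  show ?thesis
    by (rule tendsto_sandwich[OF _ _ tendsto_const lim])
       (simp, rule always_eventually, rule allI, rule le)
qed

lemma wbound_fundamental_matrix: "wbound V (fundamental_matrix Q x) ((1 + c) / (1 - r) * V x)"
  using fundamental_matrix_tail[of x 0] by simp

lemma mat_vec_deviation_pow:
  assumes f: "0 \<le> k" "\<And>y. \<bar>f y\<bar> \<le> k * V y"
  shows "mat_vec (mat_pow (Q - stationary_matrix Q) (Suc n)) f x = mat_vec (mat_pow Q (Suc n)) f x - mean \<mu> f"
proof -
  have s: "(\<lambda>y. - (pmf \<mu> y * f y)) summable_on UNIV"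
    using mean_summable_V_bounded[OF f] by (simp add: mean_summable_def summable_on_uminus)
  have "mat_vec (mat_pow (Q - stationary_matrix Q) (Suc n)) f x
      = (\<Sum>\<^sub>\<infinity>y. mat_pow Q (Suc n) x y * f y + - (pmf \<mu> y * f y))"
    unfolding mat_vec_def mat_pow_deviation by (simp add: left_diff_distrib del: mat_pow.simps)
  also have "\<dots> = mat_vec (mat_pow Q (Suc n)) f x - mean \<mu> f"
    unfolding infsum_add[OF row_finite_summable[OF row_finite_mat_pow[OF row_finite]] s] infsum_uminus
    by (simp only: mat_vec_def mean_def diff_conv_add_uminus)
  finally show ?thesis .
qed

text \<open>The series is defined entrywise; the weighted tail bound is what permits applying it to
  a \<open>V\<close>-bounded function term by term.\<close>

lemma fundamental_matrix_apply:
  assumes f: "0 \<le> k" "\<And>y. \<bar>f y\<bar> \<le> k * V y"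
  shows "(\<lambda>n. \<Sum>j<n. mat_vec (mat_pow (Q - stationary_matrix Q) j) f x) \<longlonglongrightarrow> mat_vec (fundamental_matrix Q) f x"
proof -
  define A where "A j y = mat_pow (Q - stationary_matrix Q) j x y" for j y
  let ?Z = "fundamental_matrix Q"
  have Af: "mat_vec (mat_pow (Q - stationary_matrix Q) j) f x = (\<Sum>\<^sub>\<infinity>y. A j y * f y)" for j
    by (simp only: mat_vec_def A_def)
  have tail: "wbound V (\<lambda>y. ?Z x y - (\<Sum>j<n. A j y)) ((1 + c) * V x * r ^ n / (1 - r))" for n
    unfolding A_def by (rule fundamental_matrix_tail)
  have sA: "(\<lambda>y. A j y * f y) summable_on UNIV" for j
    unfolding A_def by (rule wbound_pair(1)[OF V_nonneg wbound_deviation_pow f])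
  have "(\<Sum>\<^sub>\<infinity>y. (?Z x y - (\<Sum>j<n. A j y)) * f y) = mat_vec ?Z f x - (\<Sum>j<n. \<Sum>\<^sub>\<infinity>y. A j y * f y)" for n
  proof -
    have "mat_vec ?Z f x = (\<Sum>\<^sub>\<infinity>y. (?Z x y - (\<Sum>j<n. A j y)) * f y + (\<Sum>j<n. A j y * f y))"
      by (simp add: mat_vec_def left_diff_distrib sum_distrib_right)
    also have "\<dots> = (\<Sum>\<^sub>\<infinity>y. (?Z x y - (\<Sum>j<n. A j y)) * f y) + (\<Sum>\<^sub>\<infinity>y. \<Sum>j<n. A j y * f y)"
      by (rule infsum_add[OF wbound_pair(1)[OF V_nonneg tail f] infsum_finite_sum(1)[OF sA]])
    also have "(\<Sum>\<^sub>\<infinity>y. \<Sum>j<n. A j y * f y) = (\<Sum>j<n. \<Sum>\<^sub>\<infinity>y. A j y * f y)"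
      by (rule infsum_finite_sum(2)[OF sA])
    finally show ?thesis by simp
  qed
  moreover have "\<bar>\<Sum>\<^sub>\<infinity>y. (?Z x y - (\<Sum>j<n. A j y)) * f y\<bar> \<le> (k * (1 + c) / (1 - r)) * r ^ n * V x" for n
    using wbound_pair(4)[OF V_nonneg tail[of n] f] by (simp add: mult_ac)
  ultimately have "\<bar>mat_vec ?Z f x - (\<Sum>j<n. \<Sum>\<^sub>\<infinity>y. A j y * f y)\<bar> \<le> (k * (1 + c) / (1 - r)) * r ^ n * V x" for n
    by (simp only:)
  with r have "(\<lambda>n. mat_vec ?Z f x - (\<Sum>j<n. \<Sum>\<^sub>\<infinity>y. A j y * f y)) \<longlonglongrightarrow> 0"
    by (rule geometric_null)
  from tendsto_diff[OF tendsto_const[of "mat_vec ?Z f x"] this] show ?thesis unfolding Af by simp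
qed

lemma mean_const: "mean \<mu> (\<lambda>_. a) = a"
  unfolding mean_def by (subst infsum_cmult_left) (simp_all add: pmf_summable infsum_pmf)

text \<open>Every term after the identity annihilates constants.\<close>

lemma fundamental_matrix_const: "mat_vec (fundamental_matrix Q) (\<lambda>_. a) x = a"
proof -
  have f: "\<bar>a\<bar> \<le> \<bar>a\<bar> * V y" for y using mult_left_mono[OF V_ge_1[of y], of "\<bar>a\<bar>"] by simp
  have "(\<Sum>j<Suc n. mat_vec (mat_pow (Q - stationary_matrix Q) j) (\<lambda>_. a) x) = a" for n
    unfolding sum.lessThan_Suc_shift mat_vec_deviation_pow[OF abs_ge_zero f] mean_const
    by (simp add: mat_vec_mat_one finite_chain.mat_vec_const[OF finite_chain_mat_pow] del: mat_pow.simps(2))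
  moreover have "(\<lambda>n. \<Sum>j<Suc n. mat_vec (mat_pow (Q - stationary_matrix Q) j) (\<lambda>_. a) x)
      \<longlonglongrightarrow> mat_vec (fundamental_matrix Q) (\<lambda>_. a) x"
    by (rule LIMSEQ_Suc[OF fundamental_matrix_apply[OF abs_ge_zero f]])
  ultimately show ?thesis by (simp add: LIMSEQ_const_iff)
qed

text \<open>Multiplying the series by \<open>Q\<close> on either side shifts the index by one and
  drops the identity term. The term at \<open>j = 0\<close> needs the correction
  \<open>mean \<mu> f\<close>, because there \<open>Q\<close> exceeds the first deviation power by
  the stationary matrix.\<close>

lemma
  assumes f: "0 \<le> k" "\<And>y. \<bar>f y\<bar> \<le> k * V y"
  shows fundamental_matrix_mult_left:
      "mat_vec Q (mat_vec (fundamental_matrix Q) f) x = mat_vec (fundamental_matrix Q) f x - f x + mean \<mu> f"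
    and fundamental_matrix_mult_right:
      "mat_vec (fundamental_matrix Q) (mat_vec Q f) x = mat_vec (fundamental_matrix Q) f x - f x + mean \<mu> f"
proof -
  let ?A = "\<lambda>j. mat_vec (mat_pow (Q - stationary_matrix Q) j)"
  let ?Z = "mat_vec (fundamental_matrix Q)"
  have Qf: "0 \<le> k * (c + mean \<mu> V)" "\<And>y. \<bar>mat_vec Q f y\<bar> \<le> k * (c + mean \<mu> V) * V y"
    using mat_vec_V_bounded[OF f] f(1) c wbound_nonneg[OF wbound_stationary] by auto
  have right: "?A j (mat_vec Q f) x = ?A (Suc j) f x + (if j = 0 then mean \<mu> f else 0)" for j x
    using mat_vec_deviation_pow[OF Qf] mat_vec_deviation_pow[OF f] mat_vec_pow_Suc2[of j f x] mean_mat_vec[OF f]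
    by (cases j) (simp_all add: mat_vec_mat_one[abs_def] del: mat_pow.simps(2))
  have left: "mat_vec Q (?A j f) x = ?A (Suc j) f x + (if j = 0 then mean \<mu> f else 0)" for j x
  proof (cases j)
    case 0
    then show ?thesis using right[of 0 x] by (simp add: mat_vec_mat_one[abs_def] del: mat_pow.simps(2))
  next
    case (Suc i)
    have "?A (Suc i) f = (\<lambda>x. mat_vec (mat_pow Q (Suc i)) f x - mean \<mu> f)"
      by (rule ext) (rule mat_vec_deviation_pow[OF f])
    then show ?thesis
      unfolding Suc mat_vec_deviation_pow[OF f, of "Suc i"] mat_vec_pow_Suc[of "Suc i"]
      by (simp add: mat_vec_diff row_finite mat_vec_const del: mat_pow.simps(2))
  qed
  have sum: "(\<Sum>j<Suc n. ?A (Suc j) f x + (if j = 0 then mean \<mu> f else 0)) = (\<Sum>j<Suc (Suc n). ?A j f x) - f x + mean \<mu> f" for n x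
    unfolding sum.distrib
    by (subst (2) sum.lessThan_Suc_shift) (simp add: mat_vec_mat_one del: mat_pow.simps(2) sum.lessThan_Suc)
  note lim = fundamental_matrix_apply[OF f]
  have lim': "(\<lambda>n. (\<Sum>j<Suc (Suc n). ?A j f x) - f x + mean \<mu> f) \<longlonglongrightarrow> ?Z f x - f x + mean \<mu> f" for x
    by (intro tendsto_intros LIMSEQ_Suc[OF LIMSEQ_Suc[OF lim]])
  have "(\<lambda>n. \<Sum>j<Suc n. ?A j (mat_vec Q f) x) \<longlonglongrightarrow> ?Z (mat_vec Q f) x"
    by (rule LIMSEQ_Suc[OF fundamental_matrix_apply[OF Qf]])
  then show "?Z (mat_vec Q f) x = ?Z f x - f x + mean \<mu> f"
    unfolding right sum using lim' by (rule LIMSEQ_unique)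
  have "(\<lambda>n. mat_vec Q (\<lambda>y. \<Sum>j<Suc n. ?A j f y) x) \<longlonglongrightarrow> mat_vec Q (?Z f) x"
    by (rule mat_vec_tendsto[OF row_finite LIMSEQ_Suc[OF lim]])
  then show "mat_vec Q (?Z f) x = ?Z f x - f x + mean \<mu> f"
    unfolding mat_vec_sum[OF row_finite] left sum using lim' by (rule LIMSEQ_unique)
qed

end

section \<open>Perturbed stationary distributions\<close>

lemma vec_mat_diff:
  assumes V: "\<And>y. 1 \<le> V y" and k: "0 \<le> k" and M: "\<And>x. wbound V (M x) (k * V x)"
    and a: "wbound V a c" and a': "wbound V a' c'"
  shows "vec_mat (\<lambda>x. a x - a' x) M y = vec_mat a M y - vec_mat a' M y"
proof -
  note s = vec_mat_summable[of V, OF V a k M]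
  have s': "(\<lambda>x. - (a' x * M x y)) summable_on UNIV"
    using vec_mat_summable[of V, OF V a' k M] by (simp add: summable_on_uminus)
  show ?thesis
    unfolding vec_mat_def left_diff_distrib using infsum_add[OF s s', of y] by (simp add: infsum_uminus)
qed

lemma vec_mat_sum:
  assumes V: "\<And>y. 1 \<le> V y" and k: "0 \<le> k" and M: "\<And>x. wbound V (M x) (k * V x)"
    and a: "\<And>i. wbound V (a i) (c i)"
  shows "vec_mat (\<lambda>x. \<Sum>i<n. a i x) M y = (\<Sum>i<n. vec_mat (a i) M y)"
  unfolding vec_mat_def sum_distrib_right
  by (rule infsum_finite_sum(2)) (rule vec_mat_summable[of V, OF V a k M])

text \<open>The terms are obtained by applying \<open>M\<close> repeatedly to \<open>a\<close>, and
  their norms decay like \<open>D ^ n\<close>. The second bound omits the first term and is the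
  source of the factor \<open>D / (1 - D)\<close> in the final estimate.\<close>

lemma neumann_series:
  assumes V: "\<And>y. 1 \<le> V y" and D: "0 \<le> D" "D < 1" and M: "\<And>x. wbound V (M x) (D * V x)"
    and a: "wbound V a m"
  obtains \<nu> where "wbound V \<nu> (m / (1 - D))" "wbound V (\<lambda>y. \<nu> y - a y) (m * D / (1 - D))"
    "\<And>y. \<nu> y = a y + vec_mat \<nu> M y"
proof -
  define t where "t n = ((\<lambda>b. vec_mat b M) ^^ n) a" for n
  have t: "t 0 = a" "t (Suc n) = vec_mat (t n) M" for n by (simp_all add: t_def)
  have wt: "wbound V (t n) (m * D ^ n)" for n
  proof (induction n)
    case 0 show ?case using a by (simp add: t)
  next
    case (Suc n)
    from wbound_vec_mat[of V, OF V this D(1) M] show ?case by (simp add: t mult_ac)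
  qed
  define \<nu> where "\<nu> y = (\<Sum>n. t n y)" for y
  have tail: "wbound V (\<lambda>y. \<nu> y - (\<Sum>k<n. t k y)) (m * D ^ n / (1 - D))" for n
    unfolding \<nu>_def by (rule wbound_series(2)[OF V D wt])
  have w\<nu>: "wbound V \<nu> (m / (1 - D))" using tail[of 0] by simp
  have "\<nu> y = a y + vec_mat \<nu> M y" for y
  proof -
    have V0: "0 \<le> V y" for y using V[of y] by linarith
    have wsum: "wbound V (\<lambda>y. \<Sum>k<n. t k y) (m / (1 - D) + m * D ^ n / (1 - D))" for n
      using wbound_add[OF V0 w\<nu> wbound_uminus[OF tail[of n]]] by simp
    \<comment> \<open>Applying \<open>M\<close> to a partial sum shifts it: one more term at the
      end, and \<open>a\<close> missing at the start. What remains is \<open>M\<close> applied to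
      the tail.\<close>
    have "vec_mat \<nu> M y - ((\<Sum>k<Suc n. t k y) - a y) = vec_mat (\<lambda>y. \<nu> y - (\<Sum>k<n. t k y)) M y" for n
      using vec_mat_diff[of V, OF V D(1) M w\<nu> wsum] vec_mat_sum[of V, OF V D(1) M wt, where n = n and y = y]
      unfolding sum.lessThan_Suc_shift by (simp add: t)
    moreover have "\<bar>vec_mat (\<lambda>y. \<nu> y - (\<Sum>k<n. t k y)) M y\<bar> \<le> D * (m * D ^ n / (1 - D))" for n
    proof -
      note w = wbound_point[OF wbound_vec_mat[of V, OF V tail[of n] D(1) M], of y]
      show ?thesis using mult_left_mono[OF V[of y] abs_ge_zero[of "vec_mat (\<lambda>y. \<nu> y - (\<Sum>k<n. t k y)) M y"]] w by simp
    qed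
    ultimately have le: "\<bar>vec_mat \<nu> M y - ((\<Sum>k<Suc n. t k y) - a y)\<bar> \<le> D * (m * D ^ n / (1 - D))" for n
      by (simp only:)
    have "(\<lambda>n. D * (m * D ^ n / (1 - D))) \<longlonglongrightarrow> D * (m * 0 / (1 - D))"
      using D by (intro tendsto_intros LIMSEQ_power_zero) auto
    then have "(\<lambda>n. D * (m * D ^ n / (1 - D))) \<longlonglongrightarrow> 0" by simp
    from Lim_null_comparison[OF _ this, of "\<lambda>n. vec_mat \<nu> M y - ((\<Sum>k<Suc n. t k y) - a y)"]
    have "(\<lambda>n. vec_mat \<nu> M y - ((\<Sum>k<Suc n. t k y) - a y)) \<longlonglongrightarrow> 0" using le by simp
    moreover have "(\<lambda>n. \<Sum>k<Suc n. t k y) \<longlonglongrightarrow> \<nu> y"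
      unfolding \<nu>_def by (rule LIMSEQ_Suc[OF summable_LIMSEQ[OF wbound_series(1)[OF V D wt]]])
    then have "(\<lambda>n. vec_mat \<nu> M y - ((\<Sum>k<Suc n. t k y) - a y)) \<longlonglongrightarrow> vec_mat \<nu> M y - (\<nu> y - a y)"
      by (intro tendsto_intros)
    ultimately have "vec_mat \<nu> M y - (\<nu> y - a y) = 0" using LIMSEQ_unique by blast
    then show ?thesis by simp
  qed
  then show ?thesis using that[OF w\<nu>] tail[of 1] by (simp add: t)
qed

context ergodic_chain
begin

lemma fundamental_matrix_bounded:
  assumes "0 \<le> k" "\<And>y. \<bar>f y\<bar> \<le> k * V y"
  shows "\<bar>mat_vec (fundamental_matrix Q) f x\<bar> \<le> k * ((1 + c) / (1 - r)) * V x"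
  using wbound_pair(4)[OF V_nonneg wbound_fundamental_matrix assms, of x] by (simp add: mat_vec_def mult.assoc)

text \<open>For \<open>f\<close> of mean zero, applying \<open>Q\<close> to \<open>Z f\<close>
  subtracts \<open>f\<close>, so \<open>n\<close> steps subtract the n-th partial sum of the series.
  The result tends to zero, but also to the mean of \<open>Z f\<close>.\<close>

lemma mean_fundamental_matrix:
  assumes f: "0 \<le> k" "\<And>y. \<bar>f y\<bar> \<le> k * V y" and "mean \<mu> f = 0"
  shows "mean \<mu> (mat_vec (fundamental_matrix Q) f) = 0"
proof -
  let ?h = "mat_vec (fundamental_matrix Q) f"
  let ?S = "\<lambda>n x. \<Sum>j<n. mat_vec (mat_pow (Q - stationary_matrix Q) j) f x"
  have "mat_vec Q ?h = (\<lambda>x. ?h x - f x)"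
    using fundamental_matrix_mult_left[OF f] assms(3) by auto
  moreover have "mat_vec (mat_pow (Q - stationary_matrix Q) j) f x = mat_vec (mat_pow Q j) f x" for j x
    using mat_vec_deviation_pow[OF f] assms(3) by (cases j) (simp_all add: mat_vec_mat_one del: mat_pow.simps(2))
  ultimately have pow: "mat_vec (mat_pow Q n) ?h x = ?h x - ?S n x" for n x
    by (induction n) (simp_all add: mat_vec_mat_one mat_vec_pow_Suc2 mat_vec_diff row_finite_mat_pow row_finite del: mat_pow.simps(2))
  have "(\<lambda>n. mat_vec (mat_pow Q n) ?h x) \<longlonglongrightarrow> ?h x - ?h x" for x
    unfolding pow by (intro tendsto_intros fundamental_matrix_apply[OF f])
  moreover have "(\<lambda>n. mat_vec (mat_pow Q n) ?h x) \<longlonglongrightarrow> mean \<mu> ?h" for x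
    by (rule mat_vec_pow_tendsto_mean[OF _ fundamental_matrix_bounded[OF f]]) (use f(1) c r in auto)
  ultimately show ?thesis using LIMSEQ_unique by fastforce
qed

lemma
  assumes g: "0 \<le> k" "\<And>y. \<bar>g y\<bar> \<le> k * V y"
  shows centered_bounded: "\<bar>centered Q g y\<bar> \<le> (k + \<bar>mean \<mu> g\<bar>) * V y"
    and mean_centered: "mean \<mu> (centered Q g) = 0"
proof -
  have "\<bar>mean \<mu> g\<bar> * 1 \<le> \<bar>mean \<mu> g\<bar> * V y" by (intro mult_left_mono V_ge_1) simp
  then show "\<bar>centered Q g y\<bar> \<le> (k + \<bar>mean \<mu> g\<bar>) * V y"
    using g(2)[of y] by (simp add: centered_def stationary_Q distrib_right)
  have s: "(\<lambda>x. pmf \<mu> x * g x) summable_on UNIV" "(\<lambda>x. - (pmf \<mu> x * mean \<mu> g)) summable_on UNIV"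
    using mean_summable_V_bounded[OF g] summable_on_cmult_left[OF pmf_summable, of \<mu> "mean \<mu> g"]
    by (auto simp: mean_summable_def summable_on_uminus)
  show "mean \<mu> (centered Q g) = 0"
    using infsum_add[OF s] mean_const[of "mean \<mu> g"]
    by (simp add: mean_def[of _ "centered Q g"] centered_def stationary_Q right_diff_distrib infsum_uminus)
       (simp add: mean_def)
qed

lemma poisson_solution_fundamental:
  assumes g: "0 \<le> k" "\<And>y. \<bar>g y\<bar> \<le> k * V y"
  shows "poisson_solution Q g (mat_vec (fundamental_matrix Q) (centered Q g))"
    and "fundamental_solution Q g = mat_vec (fundamental_matrix Q) (centered Q g)"
proof -
  let ?h = "mat_vec (fundamental_matrix Q) (centered Q g)"
  have cg: "0 \<le> k + \<bar>mean \<mu> g\<bar>" "\<bar>centered Q g y\<bar> \<le> (k + \<bar>mean \<mu> g\<bar>) * V y" for y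
    using centered_bounded[OF g] g(1) by auto
  let ?l = "(k + \<bar>mean \<mu> g\<bar>) * ((1 + c) / (1 - r))"
  have h: "0 \<le> ?l" "\<bar>?h y\<bar> \<le> ?l * V y" for y
    using fundamental_matrix_bounded[OF cg] cg(1) c r by auto
  show p: "poisson_solution Q g ?h"
    unfolding poisson_solution_def stationary_Q
  proof (intro conjI allI)
    show "g x - mean \<mu> g + mat_vec Q ?h x - ?h x = 0" for x
      unfolding fundamental_matrix_mult_left[OF cg] mean_centered[OF g]
      by (simp add: centered_def stationary_Q)
    show "mean_summable \<mu> (\<lambda>x. \<bar>?h x\<bar>)"
      by (rule mean_summable_V_bounded[OF h(1)]) (use h(2) in simp)
    show "mean \<mu> ?h = 0" by (rule mean_fundamental_matrix[OF cg mean_centered[OF g]])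
  qed
  show "fundamental_solution Q g = ?h"
    unfolding fundamental_solution_def using p poisson_solution_unique[OF stationary] by blast
qed

lemma perturbed_apply:
  assumes "row_finite P" and f: "0 \<le> k" "\<And>y. \<bar>f y\<bar> \<le> k * V y"
  shows "mat_vec (mat_mult (P - Q) (fundamental_matrix Q)) f x
    = mat_vec P (mat_vec (fundamental_matrix Q) f) x - mat_vec Q (mat_vec (fundamental_matrix Q) f) x"
  by (subst mat_vec_mult)
     (use assms row_finite in \<open>auto intro: row_finite_diff wbound_pair(1)[OF V_nonneg wbound_fundamental_matrix f]
       simp: mat_vec_diff_mat\<close>)

text \<open>Everything about \<nu> is read off by pairing its fixed-point equation with suitable
  test functions: constants give the mass, columns the invariance. The last conclusion keeps that
  equation in paired form.\<close>

lemma perturbed_stationary: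
  assumes P: "irreducible_finite_chain P" and D: "0 \<le> D" "D < 1"
    and dev: "deviation V P Q \<le> ennreal D"
  obtains \<nu> where "stationary_for P \<nu>" "wbound V (pmf \<nu>) (mean \<mu> V / (1 - D))"
    "wbound V (\<lambda>y. pmf \<nu> y - pmf \<mu> y) (mean \<mu> V * D / (1 - D))"
    "\<And>k f. 0 \<le> k \<Longrightarrow> (\<forall>y. \<bar>f y\<bar> \<le> k * V y) \<Longrightarrow>
      mean \<nu> f = mean \<mu> f + mean \<nu> (mat_vec (mat_mult (P - Q) (fundamental_matrix Q)) f)"
proof -
  interpret P: irreducible_finite_chain P by fact
  let ?Z = "mat_vec (fundamental_matrix Q)"
  let ?M = "mat_mult (P - Q) (fundamental_matrix Q)"
  have M: "wbound V (?M x) (D * V x)" for x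
    by (rule wbound_mat_vnorm[OF V_ge_1 D(1) dev[unfolded deviation_def]])
  obtain \<nu> where w\<nu>: "wbound V \<nu> (mean \<mu> V / (1 - D))"
    and w\<nu>\<mu>: "wbound V (\<lambda>y. \<nu> y - pmf \<mu> y) (mean \<mu> V * D / (1 - D))"
    and \<nu>: "\<And>y. \<nu> y = pmf \<mu> y + vec_mat \<nu> ?M y"
    using neumann_series[of V D ?M, OF V_ge_1 D M wbound_stationary] by blast
  have pair: "(\<Sum>\<^sub>\<infinity>y. \<nu> y * f y) = mean \<mu> f + (\<Sum>\<^sub>\<infinity>x. \<nu> x * mat_vec ?M f x)"
    if f: "0 \<le> k" "\<And>y. \<bar>f y\<bar> \<le> k * V y" for k f
  proof -
    have "(\<Sum>\<^sub>\<infinity>y. \<nu> y * f y) = (\<Sum>\<^sub>\<infinity>y. (pmf \<mu> y + vec_mat \<nu> ?M y) * f y)" using \<nu> by simp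
    also have "\<dots> = (\<Sum>\<^sub>\<infinity>y. pmf \<mu> y * f y) + (\<Sum>\<^sub>\<infinity>y. vec_mat \<nu> ?M y * f y)"
      by (rule wbound_add_pair[OF V_nonneg wbound_stationary wbound_vec_mat[of V, OF V_ge_1 w\<nu> D(1) M] f])
    also have "(\<Sum>\<^sub>\<infinity>y. vec_mat \<nu> ?M y * f y) = (\<Sum>\<^sub>\<infinity>x. \<nu> x * mat_vec ?M f x)"
      by (rule vec_mat_pair[of V, OF V_ge_1 w\<nu> D(1) M f])
    finally show ?thesis by (simp add: mean_def)
  qed
  have one: "\<bar>1\<bar> \<le> 1 * V y" for y using V_ge_1[of y] by simp
  have Z1: "?Z (\<lambda>_. a) = (\<lambda>_. a)" for a by (rule ext) (rule fundamental_matrix_const)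
  \<comment> \<open>The fundamental matrix fixes constants and both kernels agree on them, so \<nu>
    inherits the mass of \<mu>.\<close>
  have M1: "mat_vec ?M (\<lambda>_. 1) x = 0" for x
    using perturbed_apply[OF P.row_finite zero_le_one one] by (simp add: Z1 P.mat_vec_const mat_vec_const)
  have sum1: "(\<Sum>\<^sub>\<infinity>y. \<nu> y) = 1"
    using pair[OF zero_le_one one] M1 mean_const[of 1] by simp
  have s\<nu>: "\<nu> summable_on UNIV"
    using wbound_pair(1)[OF V_nonneg w\<nu> zero_le_one one] by simp
  have inv: "vec_mat \<nu> P = \<nu>"
  proof
    fix w
    define e where "e z = mat_one z w" for z :: 'x
    have e: "\<bar>e y\<bar> \<le> 1 * V y" for y using V_ge_1[of y] by (auto simp: e_def mat_one_def)
    have Qe: "mat_vec Q e = (\<lambda>z. Q z w)" and Pe: "mat_vec P e = (\<lambda>z. P z w)"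
      unfolding e_def by (rule ext, rule mat_vec_of_mat_one, rule row_finite P.row_finite)+
    \<comment> \<open>For this test function the mean is zero and \<open>?Z ?f\<close> is
      \<open>e\<close> up to a constant, which the difference of the kernels ignores. The
      fixed-point equation becomes \<open>\<nu> (e - Q e) = \<nu> (P e - Q e)\<close>, and
      cancelling the \<open>Q\<close> terms gives invariance in column \<open>w\<close>.\<close>
    let ?f = "\<lambda>y. e y - mat_vec Q e y"
    have bnd: "\<bar>Q y w\<bar> \<le> 1 * V y" "\<bar>P y w\<bar> \<le> 1 * V y" for y
      using nonneg[of y w] entry_le_one[of y w] P.nonneg[of y w] P.entry_le_one[of y w] V_ge_1[of y] by auto
    have f: "\<bar>?f y\<bar> \<le> 2 * V y" for y
      using e[of y] bnd(1)[of y] by (simp add: Qe)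
    have Zf: "?Z ?f = (\<lambda>x. e x + - mean \<mu> e)"
    proof
      fix x
      have "?Z ?f x = ?Z e x - ?Z (mat_vec Q e) x"
      proof -
        have n: "\<bar>- mat_vec Q e y\<bar> \<le> 1 * V y" for y using bnd(1)[of y] by (simp add: Qe)
        show ?thesis
          using infsum_add[OF wbound_pair(1)[OF V_nonneg wbound_fundamental_matrix zero_le_one e, of x]
            wbound_pair(1)[OF V_nonneg wbound_fundamental_matrix zero_le_one n, of x]]
          by (simp add: mat_vec_def[of "fundamental_matrix Q"] right_diff_distrib infsum_uminus)
      qed
      then show "?Z ?f x = e x + - mean \<mu> e" by (simp add: fundamental_matrix_mult_right[OF zero_le_one e])
    qed
    have Mf: "mat_vec ?M ?f x = P x w - Q x w" for x
    proof -
      have "mat_vec ?M ?f x = mat_vec P (?Z ?f) x - mat_vec Q (?Z ?f) x"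
        by (rule perturbed_apply[OF P.row_finite _ f]) simp
      then show ?thesis
        unfolding Zf mat_vec_add[OF row_finite] mat_vec_add[OF P.row_finite] mat_vec_const P.mat_vec_const
        by (simp add: Pe Qe)
    qed
    have mf: "mean \<mu> ?f = 0"
    proof -
      have n: "\<bar>- mat_vec Q e y\<bar> \<le> 1 * V y" for y using bnd(1)[of y] by (simp add: Qe)
      show ?thesis
        using infsum_add[OF wbound_pair(1)[OF V_nonneg wbound_stationary zero_le_one e]
            wbound_pair(1)[OF V_nonneg wbound_stationary zero_le_one n]] mean_mat_vec[OF zero_le_one e]
        by (simp add: mean_def right_diff_distrib infsum_uminus)
    qed
    have s: "(\<lambda>x. \<nu> x * h x) summable_on UNIV" if "\<And>y. \<bar>h y\<bar> \<le> 1 * V y" for h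
      by (rule wbound_pair(1)[OF V_nonneg w\<nu> zero_le_one that])
    have diff: "(\<Sum>\<^sub>\<infinity>x. \<nu> x * (h x - h' x)) = (\<Sum>\<^sub>\<infinity>x. \<nu> x * h x) - (\<Sum>\<^sub>\<infinity>x. \<nu> x * h' x)"
      if h: "\<And>y. \<bar>h y\<bar> \<le> 1 * V y" "\<And>y. \<bar>h' y\<bar> \<le> 1 * V y" for h h'
    proof -
      have "(\<lambda>x. - (\<nu> x * h' x)) summable_on UNIV" using s[OF h(2)] by (simp only: summable_on_uminus)
      from infsum_add[OF s[OF h(1)] this] show ?thesis by (simp add: right_diff_distrib infsum_uminus)
    qed
    have "(\<Sum>\<^sub>\<infinity>x. \<nu> x * (e x - Q x w)) = (\<Sum>\<^sub>\<infinity>x. \<nu> x * (P x w - Q x w))"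
      using pair[of 2 ?f, OF _ f] unfolding mf Mf unfolding Qe by simp
    then have "(\<Sum>\<^sub>\<infinity>x. \<nu> x * e x) = (\<Sum>\<^sub>\<infinity>x. \<nu> x * P x w)"
      unfolding diff[OF e bnd(1)] diff[OF bnd(2) bnd(1)] by simp
    moreover have "(\<Sum>\<^sub>\<infinity>x. \<nu> x * e x) = (\<Sum>\<^sub>\<infinity>x\<in>{w}. \<nu> x * e x)"
      by (rule infsum_cong_neutral) (auto simp: e_def mat_one_def)
    ultimately show "vec_mat \<nu> P w = \<nu> w" by (simp add: vec_mat_def e_def mat_one_def)
  qed
  \<comment> \<open>A negative entry would make all of \<nu> nonpositive, contradicting total mass
    one.\<close>
  have nonneg: "0 \<le> \<nu> y" for y
  proof (rule ccontr)
    assume "\<not> 0 \<le> \<nu> y"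
    then have "\<nu> x \<le> 0" for x using P.invariant_nonpos[OF s\<nu> inv, of y x] by linarith
    then have "(\<Sum>\<^sub>\<infinity>y. \<nu> y) \<le> 0" by (intro infsum_le_finite_sums[OF s\<nu>] sum_nonpos)
    then show False using sum1 by simp
  qed
  obtain \<nu>' where \<nu>': "pmf \<nu>' = \<nu>" by (rule pmf_of_infsum[OF s\<nu> nonneg sum1])
  show ?thesis
    by (rule that[of \<nu>'])
       (use inv w\<nu> w\<nu>\<mu> pair in \<open>simp_all add: \<nu>' stationary_for_iff_vec_mat mean_def[of \<nu>']\<close>)
qed

end

section \<open>The performance bound\<close>

lemma enn2real_less_1:
  assumes "x < 1" shows "x = ennreal (enn2real x)" "enn2real x < 1"
proof -
  show eq: "x = ennreal (enn2real x)"
    using assms by (metis ennreal_enn2real ennreal_one_less_top order_less_trans)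
  show "enn2real x < 1" using assms by (subst (asm) eq) simp
qed

lemma abs_le_vec_vnorm:
  assumes V: "\<And>x. 1 \<le> V x" and "vec_vnorm V f < \<infinity>"
  shows "\<bar>f x\<bar> \<le> enn2real (vec_vnorm V f) * V x"
proof -
  have "ennreal (\<bar>f x\<bar> / V x) \<le> vec_vnorm V f" unfolding vec_vnorm_def by (rule SUP_upper) simp
  also have "\<dots> = ennreal (enn2real (vec_vnorm V f))" using assms by simp
  finally have "\<bar>f x\<bar> / V x \<le> enn2real (vec_vnorm V f)" by (simp add: ennreal_le_iff)
  then show ?thesis using V[of x] by (simp add: divide_le_eq split: if_splits)
qed

lemma vec_vnorm_finite:
  assumes V: "\<And>x. 1 \<le> V x" and f: "\<And>x. \<bar>f x\<bar> \<le> k * V x"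
  shows "vec_vnorm V f < \<infinity>"
proof -
  have "vec_vnorm V f \<le> ennreal k" unfolding vec_vnorm_def
  proof (rule SUP_least)
    fix x
    have "\<bar>f x\<bar> / V x \<le> k" using f[of x] V[of x] by (simp add: divide_le_eq split: if_splits)
    then show "ennreal (\<bar>f x\<bar> / V x) \<le> ennreal k" by (rule ennreal_leI)
  qed
  then show ?thesis by (simp add: le_less_trans[OF _ ennreal_less_top])
qed

context ergodic_chain
begin

text \<open>For a deviation below 1 the truncated subtraction is the real one and all factors are
  finite, so the extended-real formula is a real number.\<close>

lemma N2_eq:
  assumes dev: "deviation V P Q < 1" and g: "0 \<le> k" "\<And>y. \<bar>g y\<bar> \<le> k * V y"
  shows "N2 V P Q g = ennreal ((enn2real (deviation V P Q))\<^sup>2 / (1 - enn2real (deviation V P Q))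
    * enn2real (vec_vnorm V (centered Q g)) * mean \<mu> V)"
proof -
  define D where "D = enn2real (deviation V P Q)"
  define G where "G = enn2real (vec_vnorm V (centered Q g))"
  have dD: "deviation V P Q = ennreal D" and D: "0 \<le> D" "D < 1"
    unfolding D_def by (rule enn2real_less_1[OF dev] enn2real_nonneg)+
  have G: "vec_vnorm V (centered Q g) = ennreal G" "0 \<le> G"
    unfolding G_def using vec_vnorm_finite[of V "centered Q g", OF V_ge_1 centered_bounded[OF g]] by auto
  have m: "(\<Sum>\<^sub>\<infinity>x. ennreal (pmf (stationary Q) x * V x)) = ennreal (mean \<mu> V)"
    unfolding stationary_Q mean_def by (rule infsum_ennreal[OF V_summable]) (simp add: V_nonneg)
  have "1 - ennreal D = ennreal (1 - D)" using D ennreal_minus[of D 1] by simp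
  then have "(ennreal D)\<^sup>2 / (1 - ennreal D) = ennreal (D\<^sup>2 / (1 - D))"
    using D by (simp add: ennreal_power divide_ennreal)
  then show ?thesis
    unfolding N2_def dD G(1) m D_def[symmetric] G_def[symmetric] enn2real_ennreal[OF D(1)] enn2real_ennreal[OF G(2)]
    using D G(2) wbound_nonneg[OF wbound_stationary] by (simp flip: ennreal_mult)
qed

lemma perturbation_bound:
  assumes P: "irreducible_finite_chain P" and dev: "deviation V P Q < 1"
    and g: "0 \<le> k" "\<And>y. \<bar>g y\<bar> \<le> k * V y"
  obtains \<nu> where "stationary_for P \<nu>" "mean_summable \<nu> g" "mean_summable \<mu> (advantage P Q g)"
    "mean \<nu> g - mean \<mu> g \<le> N1 P Q g + enn2real (N2 V P Q g)"
proof -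
  interpret P: irreducible_finite_chain P by fact
  define D where "D = enn2real (deviation V P Q)"
  define G where "G = enn2real (vec_vnorm V (centered Q g))"
  let ?f = "centered Q g"
  let ?M = "mat_mult (P - Q) (fundamental_matrix Q)"
  let ?m = "mean \<mu> V"
  have dD: "deviation V P Q = ennreal D" and D: "0 \<le> D" "D < 1"
    unfolding D_def by (rule enn2real_less_1[OF dev] enn2real_nonneg)+
  have m: "0 \<le> ?m" by (rule wbound_nonneg[OF wbound_stationary])
  \<comment> \<open>Any \<open>V\<close>-bound makes the norm finite; the estimate then continues
    with the norm itself, as \<open>N2\<close> demands.\<close>
  have G: "0 \<le> G" "\<bar>?f x\<bar> \<le> G * V x" for x
    unfolding G_def
    by (simp, rule abs_le_vec_vnorm[OF V_ge_1 vec_vnorm_finite[of V, OF V_ge_1 centered_bounded[OF g]]])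
  obtain \<nu> where \<nu>: "stationary_for P \<nu>" and w\<nu>: "wbound V (pmf \<nu>) (?m / (1 - D))"
    and w\<nu>\<mu>: "wbound V (\<lambda>y. pmf \<nu> y - pmf \<mu> y) (?m * D / (1 - D))"
    and pair: "\<And>k f. 0 \<le> k \<Longrightarrow> (\<forall>y. \<bar>f y\<bar> \<le> k * V y) \<Longrightarrow> mean \<nu> f = mean \<mu> f + mean \<nu> (mat_vec ?M f)"
    using perturbed_stationary[OF P D eq_refl[OF dD]] by blast
  have wM: "wbound V (?M x) (D * V x)" for x
    by (rule wbound_mat_vnorm[OF V_ge_1 D(1) eq_refl[OF dD, unfolded deviation_def]])
  have GD: "0 \<le> G * D" "\<bar>mat_vec ?M ?f x\<bar> \<le> G * D * V x" for x
    using wbound_pair(4)[OF V_nonneg wM G, of x] G(1) D by (simp_all add: mat_vec_def mult.assoc)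
  \<comment> \<open>With \<open>h = Z f\<close>, the Poisson equation reads
    \<open>f - h = - Q h\<close>, so the advantage \<open>f + P h - h\<close> equals
    \<open>(P - Q) h\<close>.\<close>
  have adv: "advantage P Q g x = mat_vec ?M ?f x" for x
    unfolding perturbed_apply[OF P.row_finite G] fundamental_matrix_mult_left[OF G] mean_centered[OF g]
      advantage_def poisson_solution_fundamental(2)[OF g]
    by (simp add: centered_def stationary_Q)
  have sg: "(\<lambda>y. pmf \<nu> y * g y) summable_on UNIV" by (rule wbound_pair(1)[OF V_nonneg w\<nu> g])
  have "mean \<nu> ?f = mean \<nu> g - mean \<mu> g"
  proof -
    have "(\<lambda>y. - (pmf \<nu> y * mean \<mu> g)) summable_on UNIV"
      by (simp add: summable_on_uminus summable_on_cmult_left pmf_summable)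
    moreover have "(\<Sum>\<^sub>\<infinity>y. pmf \<nu> y * mean \<mu> g) = mean \<mu> g"
      by (subst infsum_cmult_left) (simp_all add: pmf_summable infsum_pmf)
    ultimately show ?thesis
      using infsum_add[OF sg, of "\<lambda>y. - (pmf \<nu> y * mean \<mu> g)"]
      by (simp add: mean_def[of \<nu>] centered_def stationary_Q right_diff_distrib infsum_uminus)
  qed
  moreover have "mean \<nu> ?f = mean \<nu> (mat_vec ?M ?f)"
    using pair[OF G(1)] G(2) mean_centered[OF g] by simp
  moreover have "mean \<nu> (mat_vec ?M ?f) = (\<Sum>\<^sub>\<infinity>y. (pmf \<nu> y - pmf \<mu> y) * mat_vec ?M ?f y) + mean \<mu> (mat_vec ?M ?f)"
    unfolding mean_def using wbound_add_pair[OF V_nonneg w\<nu>\<mu> wbound_stationary GD] by simp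
  moreover have "(\<Sum>\<^sub>\<infinity>y. (pmf \<nu> y - pmf \<mu> y) * mat_vec ?M ?f y) \<le> G * D * (?m * D / (1 - D))"
    using wbound_pair(4)[OF V_nonneg w\<nu>\<mu> GD] by (rule order_trans[OF abs_ge_self])
  moreover have "enn2real (N2 V P Q g) = G * D * (?m * D / (1 - D))"
    unfolding N2_eq[OF dev g] D_def[symmetric] G_def[symmetric]
    using D G(1) m by (simp add: power2_eq_square)
  moreover have "mean \<mu> (mat_vec ?M ?f) = N1 P Q g"
    unfolding N1_def stationary_Q using adv by (simp add: mean_def)
  ultimately have "mean \<nu> g - mean \<mu> g \<le> N1 P Q g + enn2real (N2 V P Q g)" by linarith
  moreover have "mean_summable \<mu> (advantage P Q g)"
    by (rule mean_summable_V_bounded[OF GD(1)]) (use GD(2) adv in simp)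
  ultimately show ?thesis using that[OF \<nu>] sg by (simp add: mean_summable_def)
qed

end

lemma finite_chain_policy_matrix:
  fixes P :: "'x \<Rightarrow> 'a::finite \<Rightarrow> 'x pmf"
  assumes "\<And>x a. finite {y. pmf (P x a) y > 0}"
  shows "finite_chain (policy_matrix P \<sigma>)"
proof
  show "0 \<le> policy_matrix P \<sigma> x y" for x y by (simp add: policy_matrix_def sum_nonneg)
  show "row_finite (policy_matrix P \<sigma>)"
    unfolding row_finite_def
  proof
    fix x
    have "{y. policy_matrix P \<sigma> x y \<noteq> 0} \<subseteq> (\<Union>a. {y. pmf (P x a) y > 0})"
    proof
      fix y assume "y \<in> {y. policy_matrix P \<sigma> x y \<noteq> 0}"
      then obtain a where "pmf (\<sigma> x) a * pmf (P x a) y \<noteq> 0"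
        unfolding policy_matrix_def by (auto elim: sum.not_neutral_contains_not_neutral)
      then have "pmf (P x a) y > 0" using pmf_nonneg[of "P x a" y] by (simp add: less_le)
      then show "y \<in> (\<Union>a. {y. pmf (P x a) y > 0})" by blast
    qed
    then show "finite {y. policy_matrix P \<sigma> x y \<noteq> 0}" by (rule finite_subset) (simp add: assms)
  qed
  show "mat_vec (policy_matrix P \<sigma>) (\<lambda>_. 1) x = 1" for x
  proof -
    have "mat_vec (policy_matrix P \<sigma>) (\<lambda>_. 1) x = (\<Sum>a\<in>UNIV. \<Sum>\<^sub>\<infinity>y. pmf (\<sigma> x) a * pmf (P x a) y)"
      unfolding mat_vec_def policy_matrix_def mult_1_right
      by (rule infsum_finite_sum(2)) (intro summable_on_cmult_right pmf_summable)
    also have "\<dots> = (\<Sum>a\<in>UNIV. pmf (\<sigma> x) a)"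
      by (subst infsum_cmult_right) (simp_all add: pmf_summable infsum_pmf)
    finally show ?thesis by (simp add: sum_pmf_eq_1)
  qed
qed

theorem theorem1:
  fixes P :: "'x::countable \<Rightarrow> 'a::finite \<Rightarrow> 'x pmf"
    and g :: "'x \<Rightarrow> real"
    and \<Theta> :: "(real ^ 'm) set"
    and \<pi> :: "real ^ 'm \<Rightarrow> 'x \<Rightarrow> 'a pmf"
    and \<eta> \<theta> :: "real ^ 'm"
    and V :: "'x \<Rightarrow> real"
    and b d :: real
    and C :: "'x set"
    and P\<^sub>\<eta> P\<^sub>\<theta> :: "'x \<Rightarrow> 'x \<Rightarrow> real"
  defines "P\<^sub>\<eta> \<equiv> policy_matrix P (\<pi> \<eta>)"
    and "P\<^sub>\<theta> \<equiv> policy_matrix P (\<pi> \<theta>)"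
  assumes "\<And>x a. finite {y. pmf (P x a) y > 0}"
    and "open \<Theta>"
    and "\<And>\<zeta>. \<zeta> \<in> \<Theta> \<Longrightarrow> irreducible_chain (policy_matrix P (\<pi> \<zeta>))"
    and "\<And>\<zeta>. \<zeta> \<in> \<Theta> \<Longrightarrow> aperiodic_chain (policy_matrix P (\<pi> \<zeta>))"
    and "\<eta> \<in> \<Theta>"
    and "\<And>x. V x \<ge> 1"
    and "0 < b" and "b < 1" and "d \<ge> 0" and "finite C"
    and "\<And>x. (\<Sum>\<^sub>\<infinity>y. P\<^sub>\<eta> x y * V y) \<le> b * V x + d * indicator C x"
    and "\<And>x. \<bar>g x\<bar> < V x"
    and "\<theta> \<in> \<Theta>"
    and "deviation V P\<^sub>\<theta> P\<^sub>\<eta> < 1"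
  shows "(\<exists>!\<mu>. stationary_for P\<^sub>\<eta> \<mu>) \<and> (\<exists>!\<mu>. stationary_for P\<^sub>\<theta> \<mu>)
    \<and> (\<lambda>n. mat_vnorm V (\<lambda>x y. fundamental_matrix P\<^sub>\<eta> x y
            - (\<Sum>k<n. mat_pow (P\<^sub>\<eta> - stationary_matrix P\<^sub>\<eta>) k x y))) \<longlonglongrightarrow> 0
    \<and> (\<exists>!h. poisson_solution P\<^sub>\<eta> g h)
    \<and> mean_summable (stationary P\<^sub>\<eta>) V \<and> mean_summable (stationary P\<^sub>\<eta>) g
    \<and> mean_summable (stationary P\<^sub>\<theta>) g
    \<and> mean_summable (stationary P\<^sub>\<eta>) (advantage P\<^sub>\<theta> P\<^sub>\<eta> g)
    \<and> N2 V P\<^sub>\<theta> P\<^sub>\<eta> g < \<infinity>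
    \<and> mean (stationary P\<^sub>\<theta>) g - mean (stationary P\<^sub>\<eta>) g
        \<le> N1 P\<^sub>\<theta> P\<^sub>\<eta> g + enn2real (N2 V P\<^sub>\<theta> P\<^sub>\<eta> g)"
proof -
  have chain: "irreducible_finite_chain (policy_matrix P (\<pi> \<zeta>))" if "\<zeta> \<in> \<Theta>" for \<zeta>
    using finite_chain_policy_matrix[of P "\<pi> \<zeta>", OF assms(3)] assms(5)[OF that]
    by (simp add: irreducible_finite_chain_def irreducible_finite_chain_axioms_def irreducible_chain_def)
  interpret \<theta>: irreducible_finite_chain P\<^sub>\<theta> unfolding P\<^sub>\<theta>_def by (rule chain) fact
  interpret \<eta>: irreducible_finite_chain P\<^sub>\<eta> unfolding P\<^sub>\<eta>_def by (rule chain) fact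
  interpret \<eta>: drift_chain P\<^sub>\<eta> V b d C
    by unfold_locales (use assms(6)[OF assms(7)] assms(8-13) in \<open>auto simp: P\<^sub>\<eta>_def mat_vec_def\<close>)
  obtain \<mu> c r where \<mu>: "stationary_for P\<^sub>\<eta> \<mu>" "0 \<le> c" "0 < r" "r < 1"
    "\<And>n x. wbound V (\<lambda>y. mat_pow P\<^sub>\<eta> n x y - pmf \<mu> y) (c * r ^ n * V x)"
    using \<eta>.geometric_ergodicity by blast
  interpret \<eta>: ergodic_chain P\<^sub>\<eta> V \<mu> c r by unfold_locales (use \<mu> assms(8) in auto)
  have g: "\<bar>g x\<bar> \<le> 1 * V x" for x using assms(14)[of x] by simp
  obtain \<nu> where \<nu>: "stationary_for P\<^sub>\<theta> \<nu>" "mean_summable \<nu> g"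
    "mean_summable \<mu> (advantage P\<^sub>\<theta> P\<^sub>\<eta> g)"
    "mean \<nu> g - mean \<mu> g \<le> N1 P\<^sub>\<theta> P\<^sub>\<eta> g + enn2real (N2 V P\<^sub>\<theta> P\<^sub>\<eta> g)"
    using \<eta>.perturbation_bound[OF \<theta>.irreducible_finite_chain_axioms assms(16) zero_le_one g] by blast
  \<comment> \<open>The definite descriptions denote the constructed distributions; for the
    perturbed chain existence is known only through the perturbation argument.\<close>
  have st: "stationary P\<^sub>\<theta> = \<nu>" "stationary P\<^sub>\<eta> = \<mu>"
    by (rule \<theta>.stationary_eq[OF \<nu>(1)] \<eta>.stationary_Q)+
  show ?thesis
    unfolding st
  proof (intro conjI)
    show "\<exists>!\<mu>. stationary_for P\<^sub>\<eta> \<mu>" using \<mu>(1) \<eta>.stationary_for_unique by blast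
    show "\<exists>!\<mu>. stationary_for P\<^sub>\<theta> \<mu>" using \<nu>(1) \<theta>.stationary_for_unique by blast
    show "(\<lambda>n. mat_vnorm V (\<lambda>x y. fundamental_matrix P\<^sub>\<eta> x y
            - (\<Sum>k<n. mat_pow (P\<^sub>\<eta> - stationary_matrix P\<^sub>\<eta>) k x y))) \<longlonglongrightarrow> 0"
      by (rule \<eta>.fundamental_matrix_converges)
    show "\<exists>!h. poisson_solution P\<^sub>\<eta> g h"
      using \<eta>.poisson_solution_fundamental(1)[OF zero_le_one g] \<eta>.poisson_solution_unique[OF \<mu>(1)] by blast
    show "mean_summable \<mu> V" using \<eta>.V_summable by (simp add: mean_summable_def)
    show "mean_summable \<mu> g" by (rule \<eta>.mean_summable_V_bounded[OF zero_le_one g])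
    show "N2 V P\<^sub>\<theta> P\<^sub>\<eta> g < \<infinity>" by (simp add: \<eta>.N2_eq[OF assms(16) zero_le_one g])
  qed (use \<nu> in auto)
qed

end
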